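(* There is an algorithm which, given a digraph $D$ on $n$ vertices, an integer $k$, and a tree decomposition of width $\mathrm{tw}$ of the underlying undirected graph of $D$, decides whether $D$ is $k$-colorable in time $k^{\mathrm{tw}}(\mathrm{tw}!)\,n^{O(1)}$.
   Context: A digraph is $k$-colorable if its vertices can be colored with $k$ colors so that each color class induces an acyclic subdigraph. The underlying graph of $D$ is the undirected graph obtained by ignoring arc orientations (and merging digons into single edges).
   Formalization: The time bound proved is max(1,k)^tw · tw! · (n+m)^{O(1)}, where m is the number of nodes of the given tree decomposition; this equals the stated bound when k ≥ 1 and m is polynomial in n. The empty digraph is given width 0. *)

theory Defs
  imports "Graph_Theory.Graph_Theory"
begin

section \<open>Digraph colouring\<close>

definition acyclic_digraph :: "('a, 'b) pre_digraph \<Rightarrow> bool" where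
  "acyclic_digraph G \<longleftrightarrow> \<not> (\<exists>p. pre_digraph.cycle G p)"

definition k_colorable :: "('a, 'b) pre_digraph \<Rightarrow> nat \<Rightarrow> bool" where
  "k_colorable G k \<longleftrightarrow> (\<exists>f :: 'a \<Rightarrow> nat. (\<forall>v \<in> verts G. f v < k) \<and>
     (\<forall>i < k. acyclic_digraph (G \<restriction> {v \<in> verts G. f v = i})))"


section \<open>Tree decompositions\<close>

text \<open>
  As in the Graph_Theory library, undirected graphs are symmetric digraphs, and the underlying
  undirected graph of a digraph is \<^const>\<open>mk_symmetric\<close>. The predicate \<^const>\<open>tree\<close> of that
  library is unsuitable here: it forbids \<^emph>\<open>directed\<close> cycles, and every edge of a symmetric digraph
  is a directed 2-cycle. The cycles of an undirected simple graph are the directed cycles of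
  length at least 3 of the corresponding symmetric digraph.
\<close>

definition undirected_tree :: "'a pair_pre_digraph \<Rightarrow> bool" where
  "undirected_tree T \<longleftrightarrow> pair_graph T \<and> Digraph_Component.connected (with_proj T) \<and>
     \<not> (\<exists>p. pre_digraph.cycle (with_proj T) p \<and> 3 \<le> length p)"

definition tree_decomposition ::
  "'a pair_pre_digraph \<Rightarrow> 't pair_pre_digraph \<Rightarrow> ('t \<Rightarrow> 'a set) \<Rightarrow> bool" where
  "tree_decomposition G T B \<longleftrightarrow>
     undirected_tree T \<and>
     (\<Union>t \<in> pverts T. B t) = pverts G \<and>
     (\<forall>(u, v) \<in> parcs G. \<exists>t \<in> pverts T. u \<in> B t \<and> v \<in> B t) \<and>
     (\<forall>v \<in> pverts G. Digraph_Component.connected (with_proj T \<restriction> {t \<in> pverts T. v \<in> B t}))"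

text \<open>
  Subtraction is truncated, so the graph without vertices gets width 0 instead of -1.
\<close>

definition td_width :: "'t pair_pre_digraph \<Rightarrow> ('t \<Rightarrow> 'a set) \<Rightarrow> nat" where
  "td_width T B = Max ((\<lambda>t. card (B t)) ` pverts T) - 1"


section \<open>Model of computation\<close>

text \<open>
  Algorithms are programs of a first-order call-by-value functional language whose only data are
  binary trees (pure Lisp S-expressions over a single atom, as in N. D. Jones, ``Computability and
  Complexity from a Programming Perspective''). Every evaluation step has unit cost. All primitives
  are constant-time pointer operations: there is no arithmetic and no equality test except the test
  for the atom, so no step hides more than a constant amount of work. A program is a list of
  function bodies, \<open>ECall i\<close> refers to the \<open>i\<close>-th one, and function 0, applied to the input, is the
  entry point. Variables are de Bruijn indices.
\<close>

datatype val = Nl | Pr val val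

fun val_fst :: "val \<Rightarrow> val" where
  "val_fst Nl = Nl"
| "val_fst (Pr a b) = a"

fun val_snd :: "val \<Rightarrow> val" where
  "val_snd Nl = Nl"
| "val_snd (Pr a b) = b"

datatype exp =
    EVar nat
  | ENil
  | EPair exp exp
  | EFst exp
  | ESnd exp
  | EIf exp exp exp
  | ELet exp exp
  | ECall nat "exp list"

type_synonym prog = "exp list"

text \<open>
  \<open>eval p env e v t\<close>: in the environment \<open>env\<close>, the expression \<open>e\<close> evaluates to \<open>v\<close> in exactly \<open>t\<close>
  steps. \<open>EIf\<close> takes its second branch iff the condition is the atom.
\<close>

inductive eval :: "prog \<Rightarrow> val list \<Rightarrow> exp \<Rightarrow> val \<Rightarrow> nat \<Rightarrow> bool"
  and evals :: "prog \<Rightarrow> val list \<Rightarrow> exp list \<Rightarrow> val list \<Rightarrow> nat \<Rightarrow> bool"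
  for p :: prog where
  eval_Var: "i < length env \<Longrightarrow> eval p env (EVar i) (env ! i) 1"
| eval_Nil: "eval p env ENil Nl 1"
| eval_Pair: "eval p env a x s \<Longrightarrow> eval p env b y t \<Longrightarrow> eval p env (EPair a b) (Pr x y) (s + t + 1)"
| eval_Fst: "eval p env a x s \<Longrightarrow> eval p env (EFst a) (val_fst x) (s + 1)"
| eval_Snd: "eval p env a x s \<Longrightarrow> eval p env (ESnd a) (val_snd x) (s + 1)"
| eval_If_Pr: "eval p env a (Pr x y) s \<Longrightarrow> eval p env b z t \<Longrightarrow>
    eval p env (EIf a b c) z (s + t + 1)"
| eval_If_Nl: "eval p env a Nl s \<Longrightarrow> eval p env c z t \<Longrightarrow> eval p env (EIf a b c) z (s + t + 1)"
| eval_Let: "eval p env a x s \<Longrightarrow> eval p (x # env) b y t \<Longrightarrow> eval p env (ELet a b) y (s + t + 1)"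
| eval_Call: "evals p env as xs s \<Longrightarrow> i < length p \<Longrightarrow> eval p xs (p ! i) y t \<Longrightarrow>
    eval p env (ECall i as) y (s + t + 1)"
| evals_Nil: "evals p env [] [] 0"
| evals_Cons: "eval p env a x s \<Longrightarrow> evals p env as xs t \<Longrightarrow> evals p env (a # as) (x # xs) (s + t)"

definition runs :: "prog \<Rightarrow> val \<Rightarrow> val \<Rightarrow> nat \<Rightarrow> bool" where
  "runs p inp out t \<longleftrightarrow> p \<noteq> [] \<and> eval p [inp] (p ! 0) out t"

inductive_cases eval_VarE: "eval p env (EVar i) v t"
inductive_cases eval_NilE: "eval p env ENil v t"
inductive_cases eval_PairE: "eval p env (EPair a b) v t"
inductive_cases eval_FstE: "eval p env (EFst a) v t"
inductive_cases eval_SndE: "eval p env (ESnd a) v t"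
inductive_cases eval_IfE: "eval p env (EIf a b c) v t"
inductive_cases eval_LetE: "eval p env (ELet a b) v t"
inductive_cases eval_CallE: "eval p env (ECall i as) v t"
inductive_cases evals_NilE: "evals p env [] xs t"
inductive_cases evals_ConsE: "evals p env (a # as) xs t"

lemma eval_deterministic:
  "eval p env e v t \<Longrightarrow> (\<forall>v' t'. eval p env e v' t' \<longrightarrow> v' = v \<and> t' = t)"
  "evals p env es vs t \<Longrightarrow> (\<forall>vs' t'. evals p env es vs' t' \<longrightarrow> vs' = vs \<and> t' = t)"
proof (induction rule: eval_evals.inducts)
  case eval_Var then show ?case by - (intro allI impI, erule eval_VarE; simp_all)
next
  case eval_Nil then show ?case by - (intro allI impI, erule eval_NilE; simp_all)
next
  case eval_Pair then show ?case by - (intro allI impI, erule eval_PairE; metis Suc_eq_plus1)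
next
  case eval_Fst then show ?case by - (intro allI impI, erule eval_FstE; metis Suc_eq_plus1)
next
  case eval_Snd then show ?case by - (intro allI impI, erule eval_SndE; metis Suc_eq_plus1)
next
  case eval_If_Pr then show ?case by - (intro allI impI, erule eval_IfE; metis Suc_eq_plus1 val.distinct(1))
next
  case eval_If_Nl then show ?case by - (intro allI impI, erule eval_IfE; metis Suc_eq_plus1 val.distinct(1))
next
  case eval_Let then show ?case by - (intro allI impI, erule eval_LetE; metis Suc_eq_plus1)
next
  case eval_Call then show ?case by - (intro allI impI, erule eval_CallE; metis Suc_eq_plus1)
next
  case evals_Nil then show ?case by - (intro allI impI, erule evals_NilE; simp_all)
next
  case evals_Cons then show ?case by - (intro allI impI, erule evals_ConsE; metis Suc_eq_plus1)
qed

corollary runs_deterministic: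
  "runs p inp out t \<Longrightarrow> runs p inp out' t' \<Longrightarrow> out' = out \<and> t' = t"
  unfolding runs_def using eval_deterministic(1) by blast


section \<open>Representation of instances\<close>

text \<open>
  Numbers are written in unary. For vertices this costs only a factor polynomial in their number.
  For the number of colours it is harmless because running times are not measured relative to the
  length of the input.
\<close>

fun enc_nat :: "nat \<Rightarrow> val" where
  "enc_nat 0 = Nl"
| "enc_nat (Suc m) = Pr Nl (enc_nat m)"

fun enc_list :: "('a \<Rightarrow> val) \<Rightarrow> 'a list \<Rightarrow> val" where
  "enc_list f [] = Nl"
| "enc_list f (x # xs) = Pr (f x) (enc_list f xs)"

definition enc_arc :: "nat \<times> nat \<Rightarrow> val" where
  "enc_arc e = Pr (enc_nat (fst e)) (enc_nat (snd e))"

definition enc_bool :: "bool \<Rightarrow> val" where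
  "enc_bool b = (if b then Pr Nl Nl else Nl)"

definition enc_digraph :: "nat \<Rightarrow> (nat \<times> nat) list \<Rightarrow> val" where
  "enc_digraph n as = Pr (enc_nat n) (enc_list enc_arc as)"

definition enc_instance ::
  "nat \<Rightarrow> (nat \<times> nat) list \<Rightarrow> nat \<Rightarrow> nat \<Rightarrow> (nat \<times> nat) list \<Rightarrow> nat list list \<Rightarrow> val" where
  "enc_instance n as k m es bs =
     Pr (enc_digraph n as) (Pr (enc_nat k) (Pr (enc_digraph m es) (enc_list (enc_list enc_nat) bs)))"

definition represents_digraph :: "nat \<Rightarrow> (nat \<times> nat) list \<Rightarrow> nat pair_pre_digraph \<Rightarrow> bool" where
  "represents_digraph n as D \<longleftrightarrow> pverts D = {..<n} \<and> distinct as \<and> set as = parcs D"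

definition represents_bags :: "nat \<Rightarrow> nat list list \<Rightarrow> (nat \<Rightarrow> nat set) \<Rightarrow> bool" where
  "represents_bags m bs B \<longleftrightarrow>
     length bs = m \<and> (\<forall>i < m. distinct (bs ! i) \<and> set (bs ! i) = B i)"

end

theory Submission
  imports Defs
begin

text \<open>
  A colouring has acyclic colour classes iff the vertices can be listed so that no monochromatic arc
  goes backwards. Restricting such a list of (vertex, colour) pairs to the bags gives one state per
  bag, and states of adjacent bags agree on the intersection of the bags. Conversely, locally valid
  states that agree along the tree edges can be glued to one list, since two linear orders that agree
  on the intersection of their domains can be amalgamated. So the problem is a constraint satisfaction
  problem on a tree, and as many rounds of arc consistency as there are nodes decide it.

  A bag with at most \<open>tw + 1\<close> vertices has at most \<open>k ^ (tw + 1) * fact (tw + 1)\<close> states. If \<open>n \<le> k\<close>,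
  the answer is yes; otherwise the superfluous factor \<open>k * (tw + 1)\<close> is at most \<open>n * n\<close>.
\<close>

section \<open>Weakest preconditions\<close>

text \<open>Acyclicity of a colour class is a global condition. An ordering makes it pairwise: a
  violation is a single backward monochromatic arc, and every arc lies inside some bag. That the
  bags containing a vertex form a subtree is what makes agreement along tree edges enough for
  gluing.

  The number of states may enter the time bound only to the first power, so two tables cannot be
  compared pair by pair. Agreement on an intersection is therefore phrased as equality of two
  restricted lists: the restrictions of one table are stored once, and each state of the other costs
  one lookup of polynomial length.

  The test \<open>n \<le> k\<close> comes before any table is built. Unary numbers are compared by
  descending in both at once, so its cost is bounded in terms of \<open>n\<close> alone, whatever
  \<open>k\<close> is.\<close>

definition wp :: "prog \<Rightarrow> val list \<Rightarrow> exp \<Rightarrow> (val \<Rightarrow> nat \<Rightarrow> bool) \<Rightarrow> bool" where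
  "wp p env e Q \<longleftrightarrow> (\<exists>v t. eval p env e v t \<and> Q v t)"

definition wps :: "prog \<Rightarrow> val list \<Rightarrow> exp list \<Rightarrow> (val list \<Rightarrow> nat \<Rightarrow> bool) \<Rightarrow> bool" where
  "wps p env es Q \<longleftrightarrow> (\<exists>vs t. evals p env es vs t \<and> Q vs t)"

definition call :: "prog \<Rightarrow> nat \<Rightarrow> val list \<Rightarrow> (val \<Rightarrow> nat \<Rightarrow> bool) \<Rightarrow> bool" where
  "call p i xs Q \<longleftrightarrow> i < length p \<and> wp p xs (p ! i) Q"

definition computes :: "prog \<Rightarrow> nat \<Rightarrow> val list \<Rightarrow> val \<Rightarrow> nat \<Rightarrow> bool" where
  "computes p i xs r T \<longleftrightarrow> call p i xs (\<lambda>v t. v = r \<and> t \<le> T)"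

text \<open>Stated as equations, these rules let the simplifier execute a function body
  symbolically. Postconditions see both the value and the step count, so correctness and cost are
  proved together; the existential in \<open>wp\<close> includes termination.\<close>

lemma wp_Var [simp]: "wp p env (EVar i) Q \<longleftrightarrow> i < length env \<and> Q (env ! i) 1"
  unfolding wp_def by (metis eval_Var eval_VarE)

lemma wp_Nil [simp]: "wp p env ENil Q \<longleftrightarrow> Q Nl 1"
  unfolding wp_def by (metis eval_Nil eval_NilE)

lemma wp_Pair [simp]:
  "wp p env (EPair a b) Q \<longleftrightarrow> wp p env a (\<lambda>x s. wp p env b (\<lambda>y t. Q (Pr x y) (s + t + 1)))"
  unfolding wp_def by (auto intro: eval_Pair elim!: eval_PairE) (metis Suc_eq_plus1 eval_Pair)

lemma wp_Fst [simp]: "wp p env (EFst a) Q \<longleftrightarrow> wp p env a (\<lambda>x s. Q (val_fst x) (s + 1))"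
  unfolding wp_def by (auto elim!: eval_FstE) (metis Suc_eq_plus1 eval_Fst)

lemma wp_Snd [simp]: "wp p env (ESnd a) Q \<longleftrightarrow> wp p env a (\<lambda>x s. Q (val_snd x) (s + 1))"
  unfolding wp_def by (auto elim!: eval_SndE) (metis Suc_eq_plus1 eval_Snd)

lemma wp_If [simp]:
  "wp p env (EIf a b c) Q \<longleftrightarrow>
     wp p env a (\<lambda>x s. if x = Nl then wp p env c (\<lambda>z t. Q z (s + t + 1))
                       else wp p env b (\<lambda>z t. Q z (s + t + 1)))"
  (is "?L \<longleftrightarrow> ?R")
proof
  assume ?L
  then obtain v t where "eval p env (EIf a b c) v t" "Q v t" unfolding wp_def by blast
  then show ?R unfolding wp_def by (elim eval_IfE) fastforce+
next
  assume ?R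
  then obtain x s where x: "eval p env a x s"
    "if x = Nl then wp p env c (\<lambda>z t. Q z (s + t + 1)) else wp p env b (\<lambda>z t. Q z (s + t + 1))"
    unfolding wp_def by blast
  show ?L
  proof (cases x)
    case Nl
    with x show ?thesis unfolding wp_def using eval_If_Nl by force
  next
    case (Pr y z)
    with x show ?thesis unfolding wp_def using eval_If_Pr by (smt (verit) val.distinct(1))
  qed
qed

lemma wp_Let [simp]:
  "wp p env (ELet a b) Q \<longleftrightarrow> wp p env a (\<lambda>x s. wp p (x # env) b (\<lambda>y t. Q y (s + t + 1)))"
  unfolding wp_def by (auto elim!: eval_LetE) (metis Suc_eq_plus1 eval_Let)

lemma wp_Call [simp]:
  "wp p env (ECall i as) Q \<longleftrightarrow> wps p env as (\<lambda>xs s. call p i xs (\<lambda>y t. Q y (s + t + 1)))"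
  unfolding wp_def wps_def call_def by (auto elim!: eval_CallE) (metis Suc_eq_plus1 eval_Call)

lemma wps_Nil [simp]: "wps p env [] Q \<longleftrightarrow> Q [] 0"
  unfolding wps_def by (auto intro: evals_Nil elim: evals_NilE)

lemma wps_Cons [simp]:
  "wps p env (a # as) Q \<longleftrightarrow> wp p env a (\<lambda>x s. wps p env as (\<lambda>xs t. Q (x # xs) (s + t)))"
  unfolding wp_def wps_def by (auto elim!: evals_ConsE) (metis evals_Cons)

text \<open>Symbolic execution stops at calls, where the specification of the callee replaces its
  body and its exact step count is weakened to the bound \<open>T\<close>.\<close>

lemma callI:
  assumes "computes p i xs r T" "\<And>t. t \<le> T \<Longrightarrow> Q r t"
  shows "call p i xs Q"
  using assms unfolding computes_def call_def wp_def by blast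

lemma computesI:
  assumes "i < length p" "wp p xs (p ! i) (\<lambda>v t. v = r \<and> t \<le> T)"
  shows "computes p i xs r T"
  using assms unfolding computes_def call_def by blast

lemma computes_mono:
  assumes "computes p i xs r T" "T \<le> T'"
  shows "computes p i xs r T'"
  using assms unfolding computes_def call_def wp_def by (meson le_trans)

section \<open>Tables of bag states\<close>

definition restr :: "nat list \<Rightarrow> (nat \<times> nat) list \<Rightarrow> (nat \<times> nat) list" where
  "restr b s = filter (\<lambda>x. fst x \<in> set b) s"

text \<open>
  A state of a bag is a list of (vertex, colour) pairs; the order of the list is the guessed order of
  the bag, and no monochromatic arc may go backwards.
\<close>

definition forward :: "(nat \<times> nat) list \<Rightarrow> nat \<times> nat \<Rightarrow> nat \<times> nat \<Rightarrow> bool" where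
  "forward as x y \<longleftrightarrow> (snd x = snd y \<longrightarrow> (fst y, fst x) \<notin> set as)"

fun inserts :: "'a \<Rightarrow> 'a list \<Rightarrow> 'a list list" where
  "inserts x [] = [[x]]"
| "inserts x (y # s) = (x # y # s) # map (Cons y) (inserts x s)"

fun colour_inserts :: "nat \<Rightarrow> nat \<Rightarrow> (nat \<times> nat) list \<Rightarrow> (nat \<times> nat) list list" where
  "colour_inserts v 0 s = []"
| "colour_inserts v (Suc k) s = inserts (v, k) s @ colour_inserts v k s"

fun states :: "nat list \<Rightarrow> nat \<Rightarrow> (nat \<times> nat) list list" where
  "states [] k = [[]]"
| "states (v # b) k = concat (map (colour_inserts v k) (states b k))"

text \<open>
  A set of values is stored as a trie that branches on the preorder traversal of its elements; the
  first argument is the stack of subtrees still to be traversed.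
\<close>

function trie_insert :: "val list \<Rightarrow> val \<Rightarrow> val" where
  "trie_insert [] tr = Pr Nl Nl"
| "trie_insert (Nl # st) tr = Pr (trie_insert st (val_fst tr)) (val_snd tr)"
| "trie_insert (Pr a b # st) tr = Pr (val_fst tr) (trie_insert (a # b # st) (val_snd tr))"
  by pat_completeness auto
text \<open>\<open>2 * size x + 1\<close> is the number of nodes of \<open>x\<close>, atoms
  included; every call removes exactly one node from the stack.\<close>

termination by (relation "measure (\<lambda>(st, tr). \<Sum>x\<leftarrow>st. 2 * size x + 1)") auto

function trie_member :: "val list \<Rightarrow> val \<Rightarrow> bool" where
  "trie_member [] tr \<longleftrightarrow> tr \<noteq> Nl"
| "trie_member (Nl # st) tr \<longleftrightarrow> trie_member st (val_fst tr)"
| "trie_member (Pr a b # st) tr \<longleftrightarrow> trie_member (a # b # st) (val_snd tr)"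
  by pat_completeness auto
termination by (relation "measure (\<lambda>(st, tr). \<Sum>x\<leftarrow>st. 2 * size x + 1)") auto

text \<open>\<open>Nl\<close> is the empty trie: both projections of the atom are the atom again, so
  a lookup that leaves the stored paths ends at \<open>Nl\<close>.\<close>

lemma trie_member_Nl [simp]: "\<not> trie_member st Nl"
proof -
  have "tr = Nl \<Longrightarrow> \<not> trie_member st tr" for tr
    by (induction st tr rule: trie_member.induct) auto
  then show ?thesis by blast
qed

text \<open>Among stacks of the same length no traversal is a proper prefix of another, so the end
  mark \<open>Pr Nl Nl\<close> never overwrites a longer path of this kind.\<close>

lemma trie_member_insert:
  "length st = length st' \<Longrightarrow>
     trie_member st (trie_insert st' tr) \<longleftrightarrow> st = st' \<or> trie_member st tr"
proof (induction st' tr arbitrary: st rule: trie_insert.induct)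
  case (1 tr)
  then show ?case by simp
next
  case (2 st' tr)
  then obtain x xs where "st = x # xs" by (cases st) auto
  with 2 show ?case by (cases x) auto
next
  case (3 a b st' tr)
  then obtain x xs where st: "st = x # xs" by (cases st) auto
  show ?case
  proof (cases x)
    case (Pr c d)
    then show ?thesis using st 3 by (simp add: 3(1))
  qed (use st in auto)
qed

definition trie_of :: "val list \<Rightarrow> val" where
  "trie_of xs = foldr (\<lambda>x. trie_insert [x]) xs Nl"

lemma trie_member_trie_of: "trie_member [x] (trie_of xs) \<longleftrightarrow> x \<in> set xs"
  unfolding trie_of_def by (induction xs) (simp_all add: trie_member_insert)

text \<open>
  \<open>X i\<close> is the table of node \<open>i\<close>. Two states agree on the intersection of their bags iff each of
  them, restricted to the bag of the other, gives the same list.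
\<close>

definition supported ::
  "(nat \<times> nat) list \<Rightarrow> nat list list \<Rightarrow> (nat \<Rightarrow> (nat \<times> nat) list list) \<Rightarrow> nat list \<Rightarrow> nat
     \<Rightarrow> (nat \<times> nat) list \<Rightarrow> bool" where
  "supported es bs X js i s \<longleftrightarrow>
     (\<forall>j \<in> set js. (i, j) \<in> set es \<longrightarrow>
        (\<exists>s' \<in> set (X j). restr (bs ! i) s' = restr (bs ! j) s))"

definition prune ::
  "(nat \<times> nat) list \<Rightarrow> nat list list \<Rightarrow> nat \<Rightarrow> (nat \<Rightarrow> (nat \<times> nat) list list)
     \<Rightarrow> nat \<Rightarrow> (nat \<times> nat) list list" where
  "prune es bs m X i = filter (supported es bs X [0..<m] i) (X i)"

definition init_tables ::
  "(nat \<times> nat) list \<Rightarrow> nat list list \<Rightarrow> nat \<Rightarrow> nat \<Rightarrow> (nat \<times> nat) list list" where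
  "init_tables as bs k i = filter (sorted_wrt (forward as)) (states (bs ! i) k)"

section \<open>The program\<close>

abbreviation ETrue :: exp where "ETrue \<equiv> EPair ENil ENil"

definition f_eq :: nat where "f_eq = 1"
definition f_mem :: nat where "f_mem = 2"
definition f_le :: nat where "f_le = 3"
definition f_append :: nat where "f_append = 4"
definition f_restr :: nat where "f_restr = 5"
definition f_forward :: nat where "f_forward = 6"
definition f_sorted :: nat where "f_sorted = 7"
definition f_cons :: nat where "f_cons = 8"
definition f_inserts :: nat where "f_inserts = 9"
definition f_cinserts :: nat where "f_cinserts = 10"
definition f_extend :: nat where "f_extend = 11"
definition f_states :: nat where "f_states = 12"
definition f_valid :: nat where "f_valid = 13"
definition f_tinsert :: nat where "f_tinsert = 14"
definition f_tmember :: nat where "f_tmember = 15"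
definition f_trie :: nat where "f_trie = 16"
definition f_filter :: nat where "f_filter = 17"
definition f_prune :: nat where "f_prune = 18"
definition f_round :: nat where "f_round = 19"
definition f_iter :: nat where "f_iter = 20"
definition f_tables :: nat where "f_tables = 21"

text \<open>
  Arguments are \<open>EVar 0\<close>, \<open>EVar 1\<close>, ... in order. A node with its table is the value
  \<open>Pr index (Pr bag table)\<close>.
\<close>

definition eq_body :: exp where
  "eq_body =
     EIf (EVar 0)
       (EIf (EVar 1)
         (EIf (ECall f_eq [EFst (EVar 0), EFst (EVar 1)])
           (ECall f_eq [ESnd (EVar 0), ESnd (EVar 1)])
           ENil)
         ENil)
       (EIf (EVar 1) ENil ETrue)"

definition mem_body :: exp where
  "mem_body =
     EIf (EVar 1)
       (EIf (ECall f_eq [EVar 0, EFst (EVar 1)]) ETrue (ECall f_mem [EVar 0, ESnd (EVar 1)]))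
       ENil"

definition le_body :: exp where
  "le_body =
     EIf (EVar 0) (EIf (EVar 1) (ECall f_le [ESnd (EVar 0), ESnd (EVar 1)]) ENil) ETrue"

definition append_body :: exp where
  "append_body =
     EIf (EVar 0) (EPair (EFst (EVar 0)) (ECall f_append [ESnd (EVar 0), EVar 1])) (EVar 1)"

definition restr_body :: exp where
  "restr_body =
     EIf (EVar 1)
       (EIf (ECall f_mem [EFst (EFst (EVar 1)), EVar 0])
         (EPair (EFst (EVar 1)) (ECall f_restr [EVar 0, ESnd (EVar 1)]))
         (ECall f_restr [EVar 0, ESnd (EVar 1)]))
       ENil"

definition forward_body :: exp where
  "forward_body =
     EIf (EVar 2)
       (EIf (ECall f_eq [ESnd (EVar 1), ESnd (EFst (EVar 2))])
         (EIf (ECall f_mem [EPair (EFst (EFst (EVar 2))) (EFst (EVar 1)), EVar 0])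
           ENil
           (ECall f_forward [EVar 0, EVar 1, ESnd (EVar 2)]))
         (ECall f_forward [EVar 0, EVar 1, ESnd (EVar 2)]))
       ETrue"

definition sorted_body :: exp where
  "sorted_body =
     EIf (EVar 1)
       (EIf (ECall f_forward [EVar 0, EFst (EVar 1), ESnd (EVar 1)])
         (ECall f_sorted [EVar 0, ESnd (EVar 1)])
         ENil)
       ETrue"

definition cons_body :: exp where
  "cons_body =
     EIf (EVar 1)
       (EPair (EPair (EVar 0) (EFst (EVar 1))) (ECall f_cons [EVar 0, ESnd (EVar 1)]))
       ENil"

definition inserts_body :: exp where
  "inserts_body =
     EIf (EVar 1)
       (EPair (EPair (EVar 0) (EVar 1))
         (ECall f_cons [EFst (EVar 1), ECall f_inserts [EVar 0, ESnd (EVar 1)]]))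
       (EPair (EPair (EVar 0) ENil) ENil)"

definition cinserts_body :: exp where
  "cinserts_body =
     EIf (EVar 1)
       (ECall f_append
         [ECall f_inserts [EPair (EVar 0) (ESnd (EVar 1)), EVar 2],
          ECall f_cinserts [EVar 0, ESnd (EVar 1), EVar 2]])
       ENil"

definition extend_body :: exp where
  "extend_body =
     EIf (EVar 2)
       (ECall f_append
         [ECall f_cinserts [EVar 0, EVar 1, EFst (EVar 2)],
          ECall f_extend [EVar 0, EVar 1, ESnd (EVar 2)]])
       ENil"

definition states_body :: exp where
  "states_body =
     EIf (EVar 0)
       (ECall f_extend [EFst (EVar 0), EVar 1, ECall f_states [ESnd (EVar 0), EVar 1]])
       ETrue"

definition valid_body :: exp where
  "valid_body =
     EIf (EVar 1)
       (EIf (ECall f_sorted [EVar 0, EFst (EVar 1)])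
         (EPair (EFst (EVar 1)) (ECall f_valid [EVar 0, ESnd (EVar 1)]))
         (ECall f_valid [EVar 0, ESnd (EVar 1)]))
       ENil"

definition tinsert_body :: exp where
  "tinsert_body =
     EIf (EVar 0)
       (EIf (EFst (EVar 0))
         (EPair (EFst (EVar 1))
           (ECall f_tinsert
             [EPair (EFst (EFst (EVar 0))) (EPair (ESnd (EFst (EVar 0))) (ESnd (EVar 0))),
              ESnd (EVar 1)]))
         (EPair (ECall f_tinsert [ESnd (EVar 0), EFst (EVar 1)]) (ESnd (EVar 1))))
       ETrue"

definition tmember_body :: exp where
  "tmember_body =
     EIf (EVar 0)
       (EIf (EFst (EVar 0))
         (ECall f_tmember
           [EPair (EFst (EFst (EVar 0))) (EPair (ESnd (EFst (EVar 0))) (ESnd (EVar 0))),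
            ESnd (EVar 1)])
         (ECall f_tmember [ESnd (EVar 0), EFst (EVar 1)]))
       (EIf (EVar 1) ETrue ENil)"

definition trie_body :: exp where
  "trie_body =
     EIf (EVar 1)
       (ECall f_tinsert
         [EPair (ECall f_restr [EVar 0, EFst (EVar 1)]) ENil,
          ECall f_trie [EVar 0, ESnd (EVar 1)]])
       ENil"

definition filter_body :: exp where
  "filter_body =
     EIf (EVar 2)
       (EIf (ECall f_tmember [EPair (ECall f_restr [EVar 0, EFst (EVar 2)]) ENil, EVar 1])
         (EPair (EFst (EVar 2)) (ECall f_filter [EVar 0, EVar 1, ESnd (EVar 2)]))
         (ECall f_filter [EVar 0, EVar 1, ESnd (EVar 2)]))
       ENil"

text \<open>Inside the \<open>ELet\<close> the arguments are shifted by one, and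
  \<open>EVar 0\<close> is the table already filtered against the remaining nodes. The trie of a
  neighbour is built once and then consulted for every state, which keeps the cost linear in the
  table lengths.\<close>

definition prune_body :: exp where
  "prune_body =
     EIf (EVar 3)
       (ELet (ECall f_prune [EVar 0, EVar 1, EVar 2, ESnd (EVar 3), EVar 4])
         (EIf (ECall f_mem [EPair (EVar 2) (EFst (EFst (EVar 4))), EVar 1])
           (ECall f_filter
             [EFst (ESnd (EFst (EVar 4))),
              ECall f_trie [EVar 3, ESnd (ESnd (EFst (EVar 4)))],
              EVar 0])
           (EVar 0)))
       (EVar 4)"

text \<open>The node list is passed twice: \<open>EVar 1\<close> keeps the old tables that are
  consulted for support, and \<open>EVar 2\<close> is traversed. Hence a round updates all nodes
  simultaneously, as \<open>prune\<close> does.\<close>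

definition round_body :: exp where
  "round_body =
     EIf (EVar 2)
       (EPair
         (EPair (EFst (EFst (EVar 2)))
           (EPair (EFst (ESnd (EFst (EVar 2))))
             (ECall f_prune
               [EVar 0, EFst (EFst (EVar 2)), EFst (ESnd (EFst (EVar 2))), EVar 1,
                ESnd (ESnd (EFst (EVar 2)))])))
         (ECall f_round [EVar 0, EVar 1, ESnd (EVar 2)]))
       ENil"

definition iter_body :: exp where
  "iter_body =
     EIf (EVar 0)
       (ECall f_iter [ESnd (EVar 0), EVar 1, ECall f_round [EVar 1, EVar 2, EVar 2]])
       (EVar 2)"

definition tables_body :: exp where
  "tables_body =
     EIf (EVar 3)
       (EPair
         (EPair (EVar 0)
           (EPair (EFst (EVar 3))
             (ECall f_valid [EVar 1, ECall f_states [EFst (EVar 3), EVar 2]])))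
         (ECall f_tables [EPair ENil (EVar 0), EVar 1, EVar 2, ESnd (EVar 3)]))
       ENil"

text \<open>The unary number \<open>m\<close> in the encoded tree doubles as the round counter. The
  answer is read off the table of node 0, the head of the list; by \<open>prune_consistent\<close>
  any node would serve.\<close>

definition main_body :: exp where
  "main_body =
     EIf (ECall f_le [EFst (EFst (EVar 0)), EFst (ESnd (EVar 0))])
       ETrue
       (EIf
         (ESnd (ESnd (EFst
           (ECall f_iter
             [EFst (EFst (ESnd (ESnd (EVar 0)))),
              ESnd (EFst (ESnd (ESnd (EVar 0)))),
              ECall f_tables
                [ENil, ESnd (EFst (EVar 0)), EFst (ESnd (EVar 0)),
                 ESnd (ESnd (ESnd (EVar 0)))]]))))
         ETrue
         ENil)"

definition colouring_prog :: prog where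
  "colouring_prog =
     [main_body, eq_body, mem_body, le_body, append_body, restr_body, forward_body, sorted_body,
      cons_body, inserts_body, cinserts_body, extend_body, states_body, valid_body, tinsert_body,
      tmember_body, trie_body, filter_body, prune_body, round_body, iter_body, tables_body]"

lemmas f_defs = f_eq_def f_mem_def f_le_def f_append_def f_restr_def f_forward_def f_sorted_def
  f_cons_def f_inserts_def f_cinserts_def f_extend_def f_states_def f_valid_def f_tinsert_def
  f_tmember_def f_trie_def f_filter_def f_prune_def f_round_def f_iter_def f_tables_def

lemma prog_nth:
  "colouring_prog ! 0 = main_body"
  "colouring_prog ! f_eq = eq_body" "colouring_prog ! f_mem = mem_body"
  "colouring_prog ! f_le = le_body" "colouring_prog ! f_append = append_body"
  "colouring_prog ! f_restr = restr_body" "colouring_prog ! f_forward = forward_body"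
  "colouring_prog ! f_sorted = sorted_body" "colouring_prog ! f_cons = cons_body"
  "colouring_prog ! f_inserts = inserts_body" "colouring_prog ! f_cinserts = cinserts_body"
  "colouring_prog ! f_extend = extend_body" "colouring_prog ! f_states = states_body"
  "colouring_prog ! f_valid = valid_body" "colouring_prog ! f_tinsert = tinsert_body"
  "colouring_prog ! f_tmember = tmember_body" "colouring_prog ! f_trie = trie_body"
  "colouring_prog ! f_filter = filter_body" "colouring_prog ! f_prune = prune_body"
  "colouring_prog ! f_round = round_body" "colouring_prog ! f_iter = iter_body"
  "colouring_prog ! f_tables = tables_body"
  by (simp_all add: f_defs colouring_prog_def)

lemma prog_length:
  "f_eq < length colouring_prog" "f_mem < length colouring_prog" "f_le < length colouring_prog"
  "f_append < length colouring_prog" "f_restr < length colouring_prog"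
  "f_forward < length colouring_prog" "f_sorted < length colouring_prog"
  "f_cons < length colouring_prog" "f_inserts < length colouring_prog"
  "f_cinserts < length colouring_prog" "f_extend < length colouring_prog"
  "f_states < length colouring_prog" "f_valid < length colouring_prog"
  "f_tinsert < length colouring_prog" "f_tmember < length colouring_prog"
  "f_trie < length colouring_prog" "f_filter < length colouring_prog"
  "f_prune < length colouring_prog" "f_round < length colouring_prog"
  "f_iter < length colouring_prog" "f_tables < length colouring_prog"
  by (simp_all add: f_defs colouring_prog_def)

section \<open>Correctness and cost of the program\<close>

lemma enc_bool_simps [simp]:
  "enc_bool True = Pr Nl Nl" "enc_bool False = Nl" "enc_bool b = Nl \<longleftrightarrow> \<not> b"
  "Nl = enc_bool b \<longleftrightarrow> \<not> b"
  by (simp_all add: enc_bool_def)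

lemma size_enc_nat [simp]: "size (enc_nat n) = n"
  by (induction n) auto

lemma enc_nat_inject [simp]: "enc_nat a = enc_nat b \<longleftrightarrow> a = b"
  by (metis size_enc_nat)

lemma enc_arc_inject [simp]: "enc_arc a = enc_arc b \<longleftrightarrow> a = b"
  by (cases a; cases b) (simp add: enc_arc_def)

lemma enc_list_inject:
  assumes "\<And>x y. f x = f y \<longleftrightarrow> x = y"
  shows "enc_list f xs = enc_list f ys \<longleftrightarrow> xs = ys"
proof (induction xs arbitrary: ys)
  case Nil
  then show ?case by (cases ys) auto
next
  case (Cons x xs)
  then show ?case by (cases ys) (auto simp: assms)
qed

lemma enc_state_inject [simp]: "enc_list enc_arc s = enc_list enc_arc s' \<longleftrightarrow> s = s'"
  by (rule enc_list_inject) simp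

lemma enc_arc_sel [simp]:
  "val_fst (enc_arc x) = enc_nat (fst x)" "val_snd (enc_arc x) = enc_nat (snd x)"
  "Pr (enc_nat u) (enc_nat v) = enc_arc (u, v)" "enc_arc x \<noteq> Nl"
  "size (enc_arc x) = fst x + snd x + 1"
  by (simp_all add: enc_arc_def)

text \<open>The recursion descends in both arguments at once, so the size of the first alone bounds
  the cost. Therefore \<open>computes_mem\<close> can do without a bound on the size of the list
  elements.\<close>

lemma computes_eq: "computes colouring_prog f_eq [a, b] (enc_bool (a = b)) (30 * size a + 8)"
proof (induction a arbitrary: b)
  case Nl
  show ?case
    by (rule computesI[OF prog_length(1)]) (simp add: prog_nth eq_body_def)
next
  case (Pr a1 a2)
  show ?case
  proof (cases b)
    case Nl
    show ?thesis
      by (rule computesI[OF prog_length(1)]) (simp add: prog_nth eq_body_def Nl)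
  next
    case b: (Pr b1 b2)
    show ?thesis
      apply (rule computesI[OF prog_length(1)])
      apply (simp add: prog_nth eq_body_def b)
      apply (rule callI[OF Pr(1)])
      apply simp
      apply safe
       apply (rule callI[OF Pr(2)])
       apply simp
      done
  qed
qed

lemma computes_mem:
  assumes "\<And>y z. f y = f z \<longleftrightarrow> y = z" "size (f x) \<le> N" "length ys \<le> L"
  shows "computes colouring_prog f_mem [f x, enc_list f ys] (enc_bool (x \<in> set ys))
           (L * (30 * N + 40) + 20)"
proof -
  have "computes colouring_prog f_mem [f x, enc_list f ys] (enc_bool (x \<in> set ys))
           (length ys * (30 * N + 40) + 20)"
  proof (induction ys)
    case Nil
    show ?case
      by (rule computesI[OF prog_length(2)]) (simp add: prog_nth mem_body_def)
  next
    case (Cons y ys)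
    show ?case
      apply (rule computesI[OF prog_length(2)])
      apply (simp add: prog_nth mem_body_def)
      apply (rule callI[OF computes_eq])
      apply (use assms(2) in \<open>simp add: assms(1)\<close>)
      apply safe
      apply (rule callI[OF Cons])
      apply simp
      done
  qed
  then show ?thesis
    by (rule computes_mono) (simp add: assms)
qed

definition small :: "nat \<Rightarrow> (nat \<times> nat) list \<Rightarrow> bool" where
  "small N s \<longleftrightarrow> length s \<le> N \<and> (\<forall>x \<in> set s. fst x \<le> N \<and> snd x \<le> N)"

text \<open>
  Bounds on the running times, when vertices, colours, bags and the tree have size at most \<open>N\<close>, arc
  lists have length at most \<open>N * N\<close> and tables have at most \<open>W\<close> entries. They are linear in \<open>W\<close>
  because supporting states are looked up in a trie instead of being searched for.
\<close>

definition c_mem :: "nat \<Rightarrow> nat" where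
  "c_mem N = N * N * (30 * (2 * N + 1) + 40) + 20"
definition c_restr :: "nat \<Rightarrow> nat" where
  "c_restr N = N * (c_mem N + 60) + 20"
definition c_forward :: "nat \<Rightarrow> nat" where
  "c_forward N = N * (30 * N + c_mem N + 100) + 20"
definition c_sorted :: "nat \<Rightarrow> nat" where
  "c_sorted N = N * (c_forward N + 60) + 20"
definition c_inserts :: "nat \<Rightarrow> nat" where
  "c_inserts N = N * (20 * N + 80) + 20"
definition c_cinserts :: "nat \<Rightarrow> nat" where
  "c_cinserts N = N * (c_inserts N + 20 * (N + 1) + 100) + 20"
definition c_extend :: "nat \<Rightarrow> nat \<Rightarrow> nat" where
  "c_extend N W = W * (c_cinserts N + 20 * (N * (N + 1)) + 100) + 20"
definition c_states :: "nat \<Rightarrow> nat \<Rightarrow> nat" where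
  "c_states N W = N * (c_extend N W + 60) + 20"
definition c_valid :: "nat \<Rightarrow> nat \<Rightarrow> nat" where
  "c_valid N W = W * (c_sorted N + 60) + 20"
text \<open>\<open>N * (2 * N + 2)\<close> bounds the size of an encoded state
  (\<open>size_enc_state\<close>); doubling and adding one gives its number of nodes, each of which
  costs one trie step.\<close>

definition c_tinsert :: "nat \<Rightarrow> nat" where
  "c_tinsert N = 40 * (2 * (N * (2 * N + 2)) + 1) + 20"
definition c_trie :: "nat \<Rightarrow> nat \<Rightarrow> nat" where
  "c_trie N W = W * (c_restr N + c_tinsert N + 60) + 20"
text \<open>Twice \<open>c_trie\<close>, once for building the trie and once for filtering with
  it.\<close>

definition c_prune :: "nat \<Rightarrow> nat \<Rightarrow> nat" where
  "c_prune N W = N * (c_mem N + 2 * c_trie N W + 100) + 20"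
definition c_round :: "nat \<Rightarrow> nat \<Rightarrow> nat" where
  "c_round N W = N * (c_prune N W + 100) + 20"
definition c_iter :: "nat \<Rightarrow> nat \<Rightarrow> nat" where
  "c_iter N W = N * (c_round N W + 60) + 20"
definition c_tables :: "nat \<Rightarrow> nat \<Rightarrow> nat" where
  "c_tables N W = N * (c_states N W + c_valid N W + 100) + 20"
definition c_main :: "nat \<Rightarrow> nat \<Rightarrow> nat" where
  "c_main N W = 20 * N + c_iter N W + c_tables N W + 200"

lemma small_ConsD: "small N (x # s) \<Longrightarrow> fst x \<le> N \<and> snd x \<le> N \<and> small N s"
  by (auto simp: small_def)

lemma small_restr: "small N s \<Longrightarrow> small N (restr b s)"
  unfolding small_def restr_def by (auto intro: le_trans[OF length_filter_le])

lemma size_enc_state: "small N s \<Longrightarrow> size (enc_list enc_arc s) \<le> N * (2 * N + 2)"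
proof -
  assume s: "small N s"
  have "\<forall>x \<in> set s. fst x \<le> N \<and> snd x \<le> N \<Longrightarrow> size (enc_list enc_arc s) \<le> length s * (2 * N + 2)"
    by (induction s) auto
  also have "\<dots> \<le> N * (2 * N + 2)"
    using s by (intro mult_le_mono1) (simp add: small_def)
  finally show ?thesis using s by (simp add: small_def)
qed

lemma computes_mem_nat:
  assumes "v \<le> N" "length b \<le> N"
  shows "computes colouring_prog f_mem [enc_nat v, enc_list enc_nat b] (enc_bool (v \<in> set b)) (c_mem N)"
proof -
  have "length b \<le> N * N" using assms(2) by (cases N) auto
  then show ?thesis
    unfolding c_mem_def using assms(1) by (intro computes_mem) auto
qed

lemma computes_mem_arc:
  assumes "fst e \<le> N" "snd e \<le> N" "length as \<le> N * N"
  shows "computes colouring_prog f_mem [enc_arc e, enc_list enc_arc as] (enc_bool (e \<in> set as)) (c_mem N)"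
  unfolding c_mem_def using assms by (intro computes_mem) auto

section \<open>Comparison, concatenation and operations on a single state\<close>

lemma computes_le:
  "computes colouring_prog f_le [enc_nat a, enc_nat b] (enc_bool (a \<le> b)) (20 * a + 20)"
proof (induction a arbitrary: b)
  case 0
  show ?case
    by (rule computesI[OF prog_length(3)]) (simp add: prog_nth le_body_def)
next
  case (Suc a)
  show ?case
  proof (cases b)
    case 0
    then show ?thesis
      by (intro computesI[OF prog_length(3)]) (simp add: prog_nth le_body_def)
  next
    case (Suc b')
    then show ?thesis
      apply (intro computesI[OF prog_length(3)])
      apply (simp add: prog_nth le_body_def)
      apply (rule callI[OF Suc.IH])
      apply simp
      done
  qed
qed

lemma computes_append:
  "computes colouring_prog f_append [enc_list f xs, enc_list f ys] (enc_list f (xs @ ys))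
     (20 * length xs + 20)"
proof (induction xs)
  case Nil
  show ?case
    by (rule computesI[OF prog_length(4)]) (simp add: prog_nth append_body_def)
next
  case (Cons x xs)
  show ?case
    apply (rule computesI[OF prog_length(4)])
    apply (simp add: prog_nth append_body_def)
    apply (rule callI[OF Cons])
    apply simp
    done
qed

lemma computes_restr:
  assumes "small N s" "length b \<le> N"
  shows "computes colouring_prog f_restr [enc_list enc_nat b, enc_list enc_arc s]
           (enc_list enc_arc (restr b s)) (c_restr N)"
proof -
  have "computes colouring_prog f_restr [enc_list enc_nat b, enc_list enc_arc s]
           (enc_list enc_arc (restr b s)) (length s * (c_mem N + 60) + 20)"
    using assms(1)
  proof (induction s)
    case Nil
    show ?case
      by (rule computesI[OF prog_length(5)]) (simp add: prog_nth restr_body_def restr_def)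
  next
    case (Cons x s)
    note sm = small_ConsD[OF Cons.prems]
    show ?case
      apply (rule computesI[OF prog_length(5)])
      apply (simp add: prog_nth restr_body_def)
      apply (rule callI[OF computes_mem_nat[where N = N]])
        apply (simp_all add: sm assms(2))
      apply (intro conjI impI; rule callI[OF Cons.IH])
      apply (simp_all add: sm restr_def)
      done
  qed
  then show ?thesis
    by (rule computes_mono) (use assms in \<open>simp add: c_restr_def small_def\<close>)
qed

lemma computes_forward:
  assumes "small N r" "fst x \<le> N" "snd x \<le> N" "length as \<le> N * N"
  shows "computes colouring_prog f_forward [enc_list enc_arc as, enc_arc x, enc_list enc_arc r]
           (enc_bool (\<forall>y \<in> set r. forward as x y)) (c_forward N)"
proof -
  have "computes colouring_prog f_forward [enc_list enc_arc as, enc_arc x, enc_list enc_arc r]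
           (enc_bool (\<forall>y \<in> set r. forward as x y)) (length r * (30 * N + c_mem N + 100) + 20)"
    using assms(1)
  proof (induction r)
    case Nil
    show ?case
      by (rule computesI[OF prog_length(6)]) (simp add: prog_nth forward_body_def)
  next
    case (Cons y r)
    note sm = small_ConsD[OF Cons.prems]
    show ?case
      apply (rule computesI[OF prog_length(6)])
      apply (simp add: prog_nth forward_body_def)
      apply (rule callI[OF computes_eq])
      apply simp
      apply (intro conjI impI)
       apply (rule callI[OF Cons.IH])
        apply (simp add: sm)
       apply (use assms(3) in \<open>simp add: forward_def\<close>)
      apply (rule callI[OF computes_mem_arc[where N = N]])
         apply (simp_all add: sm assms)
      apply (intro conjI impI)
       apply (rule callI[OF Cons.IH])
        apply (simp add: sm)
       apply (use assms(3) in \<open>simp_all add: forward_def\<close>)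
      done
  qed
  then show ?thesis
    by (rule computes_mono) (use assms in \<open>simp add: c_forward_def small_def\<close>)
qed

lemma computes_sorted:
  assumes "small N s" "length as \<le> N * N"
  shows "computes colouring_prog f_sorted [enc_list enc_arc as, enc_list enc_arc s]
           (enc_bool (sorted_wrt (forward as) s)) (c_sorted N)"
proof -
  have "computes colouring_prog f_sorted [enc_list enc_arc as, enc_list enc_arc s]
           (enc_bool (sorted_wrt (forward as) s)) (length s * (c_forward N + 60) + 20)"
    using assms(1)
  proof (induction s)
    case Nil
    show ?case
      by (rule computesI[OF prog_length(7)]) (simp add: prog_nth sorted_body_def)
  next
    case (Cons x s)
    note sm = small_ConsD[OF Cons.prems]
    show ?case
      apply (rule computesI[OF prog_length(7)])
      apply (simp add: prog_nth sorted_body_def)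
      apply (rule callI[OF computes_forward[where N = N]])
          apply (simp_all add: sm assms)
      apply (intro conjI impI)
      apply (rule callI[OF Cons.IH])
       apply (simp_all add: sm)
      done
  qed
  then show ?thesis
    by (rule computes_mono) (use assms in \<open>simp add: c_sorted_def small_def\<close>)
qed

section \<open>Enumeration of the states of a bag\<close>

lemma computes_cons:
  "computes colouring_prog f_cons [f y, enc_list (enc_list f) ss]
     (enc_list (enc_list f) (map (Cons y) ss)) (20 * length ss + 20)"
proof (induction ss)
  case Nil
  show ?case
    by (rule computesI[OF prog_length(8)]) (simp add: prog_nth cons_body_def)
next
  case (Cons s ss)
  show ?case
    apply (rule computesI[OF prog_length(8)])
    apply (simp add: prog_nth cons_body_def)
    apply (rule callI[OF Cons])
    apply simp
    done
qed

lemma length_inserts [simp]: "length (inserts x s) = length s + 1"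
  by (induction s) auto

lemma computes_inserts:
  assumes "length s \<le> N"
  shows "computes colouring_prog f_inserts [f x, enc_list f s]
           (enc_list (enc_list f) (inserts x s)) (c_inserts N)"
proof -
  have "computes colouring_prog f_inserts [f x, enc_list f s]
           (enc_list (enc_list f) (inserts x s)) (length s * (20 * length s + 80) + 20)"
  proof (induction s)
    case Nil
    show ?case
      by (rule computesI[OF prog_length(9)]) (simp add: prog_nth inserts_body_def)
  next
    case (Cons y s)
    show ?case
      apply (rule computesI[OF prog_length(9)])
      apply (simp add: prog_nth inserts_body_def)
      apply (rule callI[OF Cons])
      apply (rule callI[OF computes_cons[where f = f]])
      apply (simp add: algebra_simps)
      done
  qed
  then show ?thesis
    unfolding c_inserts_def using assms by (elim computes_mono) (intro add_mono mult_mono; simp)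
qed

lemma length_colour_inserts: "length (colour_inserts v k s) = k * (length s + 1)"
  by (induction k) auto

lemma computes_cinserts:
  assumes "length s \<le> N" "k \<le> N"
  shows "computes colouring_prog f_cinserts [enc_nat v, enc_nat k, enc_list enc_arc s]
           (enc_list (enc_list enc_arc) (colour_inserts v k s)) (c_cinserts N)"
proof -
  have "computes colouring_prog f_cinserts [enc_nat v, enc_nat k, enc_list enc_arc s]
           (enc_list (enc_list enc_arc) (colour_inserts v k s))
           (k * (c_inserts N + 20 * (N + 1) + 100) + 20)"
  proof (induction k)
    case 0
    show ?case
      by (rule computesI[OF prog_length(10)]) (simp add: prog_nth cinserts_body_def)
  next
    case (Suc k)
    show ?case
      apply (rule computesI[OF prog_length(10)])
      apply (simp add: prog_nth cinserts_body_def)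
      apply (rule callI[OF computes_inserts[where f = enc_arc, OF assms(1)]])
      apply (rule callI[OF Suc])
      apply simp
      apply (rule callI[OF computes_append])
      apply (use assms(1) in simp)
      done
  qed
  then show ?thesis
    by (rule computes_mono) (use assms in \<open>simp add: c_cinserts_def\<close>)
qed

lemma computes_extend:
  assumes "\<And>s. s \<in> set ss \<Longrightarrow> length s \<le> N" "k \<le> N" "length ss \<le> W"
  shows "computes colouring_prog f_extend
           [enc_nat v, enc_nat k, enc_list (enc_list enc_arc) ss]
           (enc_list (enc_list enc_arc) (concat (map (colour_inserts v k) ss))) (c_extend N W)"
proof -
  have "computes colouring_prog f_extend
           [enc_nat v, enc_nat k, enc_list (enc_list enc_arc) ss]
           (enc_list (enc_list enc_arc) (concat (map (colour_inserts v k) ss)))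
           (length ss * (c_cinserts N + 20 * (N * (N + 1)) + 100) + 20)"
    using assms(1)
  proof (induction ss)
    case Nil
    show ?case
      by (rule computesI[OF prog_length(11)]) (simp add: prog_nth extend_body_def)
  next
    case (Cons s ss)
    have s: "length s \<le> N" by (simp add: Cons.prems)
    have l: "length (colour_inserts v k s) \<le> N * (N + 1)"
      unfolding length_colour_inserts by (intro mult_le_mono) (use s assms in auto)
    show ?case
      apply (rule computesI[OF prog_length(11)])
      apply (simp add: prog_nth extend_body_def)
      apply (rule callI[OF computes_cinserts[OF s assms(2)]])
      apply (rule callI[OF Cons.IH])
       apply (simp add: Cons.prems)
      apply simp
      apply (rule callI[OF computes_append])
      apply (use l in simp)
      done
  qed
  then show ?thesis
    by (rule computes_mono) (use assms in \<open>simp add: c_extend_def\<close>)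
qed

lemma inserts_iff: "s' \<in> set (inserts x s) \<longleftrightarrow> (\<exists>ys zs. s = ys @ zs \<and> s' = ys @ x # zs)"
proof (induction s arbitrary: s')
  case (Cons y s)
  have "(\<exists>ys zs. y # s = ys @ zs \<and> s' = ys @ x # zs) \<longleftrightarrow>
      s' = x # y # s \<or> (\<exists>ys zs. s = ys @ zs \<and> s' = y # ys @ x # zs)" (is "?L \<longleftrightarrow> ?R")
  proof
    assume ?L
    then obtain ys zs where "y # s = ys @ zs" "s' = ys @ x # zs" by blast
    then show ?R by (cases ys) auto
  next
    assume ?R
    then show ?L
    proof
      assume "s' = x # y # s"
      then show ?L by (intro exI[of _ "[]"] exI[of _ "y # s"]) simp
    next
      assume "\<exists>ys zs. s = ys @ zs \<and> s' = y # ys @ x # zs"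
      then obtain ys zs where "s = ys @ zs" "s' = y # ys @ x # zs" by blast
      then show ?L by (intro exI[of _ "y # ys"] exI[of _ zs]) simp
    qed
  qed
  moreover have "s' \<in> set (inserts x (y # s)) \<longleftrightarrow>
      s' = x # y # s \<or> (\<exists>u. u \<in> set (inserts x s) \<and> s' = y # u)"
    by auto
  ultimately show ?case
    unfolding Cons by blast
qed auto

lemma colour_inserts_iff:
  "s' \<in> set (colour_inserts v k s) \<longleftrightarrow> (\<exists>ys zs c. c < k \<and> s = ys @ zs \<and> s' = ys @ (v, c) # zs)"
proof (induction k)
  case (Suc k)
  have "s' \<in> set (colour_inserts v (Suc k) s) \<longleftrightarrow> (\<exists>ys zs. s = ys @ zs \<and> s' = ys @ (v, k) # zs) \<or>
      (\<exists>ys zs c. c < k \<and> s = ys @ zs \<and> s' = ys @ (v, c) # zs)"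
    by (simp add: inserts_iff Suc)
  then show ?case
    unfolding less_Suc_eq by blast
qed simp

text \<open>Distinctness makes \<open>v\<close> new to \<open>b\<close>, so deleting its pair from a
  listing of \<open>v # b\<close> leaves a listing of \<open>b\<close>, and reinserting the pair
  recovers the original.\<close>

lemma states_iff:
  assumes "distinct b"
  shows "s \<in> set (states b k) \<longleftrightarrow>
    distinct (map fst s) \<and> fst ` set s = set b \<and> (\<forall>x \<in> set s. snd x < k)"
  using assms
proof (induction b arbitrary: s)
  case Nil
  then show ?case by auto
next
  case (Cons v b)
  show ?case
  proof
    assume "s \<in> set (states (v # b) k)"
    then obtain ys zs c where "c < k" "ys @ zs \<in> set (states b k)" "s = ys @ (v, c) # zs"
      by (auto simp: colour_inserts_iff)
    then show "distinct (map fst s) \<and> fst ` set s = set (v # b) \<and> (\<forall>x \<in> set s. snd x < k)"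
      using Cons by auto
  next
    assume s: "distinct (map fst s) \<and> fst ` set s = set (v # b) \<and> (\<forall>x \<in> set s. snd x < k)"
    then obtain c where "(v, c) \<in> set s" by (metis (no_types, lifting) imageE list.set_intros(1) prod.collapse)
    then obtain ys zs where split: "s = ys @ (v, c) # zs" by (meson split_list)
    have "fst ` set (ys @ zs) = set b"
      using s Cons.prems unfolding split by auto
    then have "ys @ zs \<in> set (states b k)"
      using s Cons unfolding split by auto
    moreover have "c < k" using s unfolding split by auto
    then have "s \<in> set (colour_inserts v k (ys @ zs))"
      unfolding colour_inserts_iff split by blast
    ultimately show "s \<in> set (states (v # b) k)"
      by auto
  qed
qed

lemma length_states_elem: "s \<in> set (states b k) \<Longrightarrow> length s = length b"
  by (induction b arbitrary: s) (fastforce simp: colour_inserts_iff)+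

lemma states_small:
  assumes "distinct b" "\<And>v. v \<in> set b \<Longrightarrow> v \<le> N" "k \<le> N" "length b \<le> N" "s \<in> set (states b k)"
  shows "small N s"
proof -
  have "fst ` set s = set b" "\<forall>x \<in> set s. snd x < k" using assms states_iff by blast+
  then show ?thesis
    using assms length_states_elem[OF assms(5)] by (fastforce simp: small_def)
qed

text \<open>A state of length \<open>l\<close> offers \<open>l + 1\<close> positions and
  \<open>k\<close> colours to the next vertex, so each vertex multiplies the count by
  \<open>k * (l + 1)\<close>.\<close>

lemma length_states: "length (states b k) = k ^ length b * fact (length b)"
proof (induction b)
  case (Cons v b)
  have "length (states (v # b) k) = (\<Sum>s\<leftarrow>states b k. k * (length s + 1))"
    by (simp add: length_concat o_def length_colour_inserts)
  also have "\<dots> = (\<Sum>s\<leftarrow>states b k. k * (length b + 1))"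
    by (intro arg_cong[where f = sum_list] map_cong) (auto simp: length_states_elem)
  also have "\<dots> = k ^ length (v # b) * fact (length (v # b))"
    by (simp add: sum_list_triv Cons algebra_simps)
  finally show ?case .
qed simp

text \<open>The recursion also builds the tables of all suffixes of the bag. For
  \<open>k = 0\<close> the empty suffix has one state although the whole bag may have none; with
  base \<open>max 1 k\<close> the count is monotone in the length, so \<open>W\<close> bounds every
  intermediate table.\<close>

lemma computes_states:
  assumes "length b \<le> N" "k \<le> N" "max 1 k ^ length b * fact (length b) \<le> W"
  shows "computes colouring_prog f_states [enc_list enc_nat b, enc_nat k]
           (enc_list (enc_list enc_arc) (states b k)) (c_states N W)"
proof -
  have "computes colouring_prog f_states [enc_list enc_nat b, enc_nat k]
           (enc_list (enc_list enc_arc) (states b k)) (length b * (c_extend N W + 60) + 20)"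
    using assms(1,3)
  proof (induction b)
    case Nil
    show ?case
      by (rule computesI[OF prog_length(12)]) (simp add: prog_nth states_body_def)
  next
    case (Cons v b)
    have "max 1 k ^ length b * fact (length b) \<le> max 1 k ^ length (v # b) * fact (length (v # b))"
      by (intro mult_le_mono power_increasing fact_mono) auto
    then have W: "max 1 k ^ length b * fact (length b) \<le> W" using Cons.prems by linarith
    have "length (states b k) \<le> max 1 k ^ length b * fact (length b)"
      unfolding length_states by (intro mult_le_mono1 power_mono) auto
    with W have l: "length (states b k) \<le> W" by linarith
    show ?case
      apply (rule computesI[OF prog_length(12)])
      apply (simp add: prog_nth states_body_def)
      apply (rule callI[OF Cons.IH])
        apply (use Cons.prems in simp)
       apply (rule W)
      apply (rule callI[OF computes_extend[OF _ assms(2) l]])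
       apply (use Cons.prems in \<open>simp add: length_states_elem\<close>)
      apply simp
      done
  qed
  then show ?thesis
    by (rule computes_mono) (use assms in \<open>simp add: c_states_def\<close>)
qed

lemma computes_valid:
  assumes "\<And>s. s \<in> set ss \<Longrightarrow> small N s" "length as \<le> N * N" "length ss \<le> W"
  shows "computes colouring_prog f_valid [enc_list enc_arc as, enc_list (enc_list enc_arc) ss]
           (enc_list (enc_list enc_arc) (filter (sorted_wrt (forward as)) ss)) (c_valid N W)"
proof -
  have "computes colouring_prog f_valid [enc_list enc_arc as, enc_list (enc_list enc_arc) ss]
           (enc_list (enc_list enc_arc) (filter (sorted_wrt (forward as)) ss))
           (length ss * (c_sorted N + 60) + 20)"
    using assms(1)
  proof (induction ss)
    case Nil
    show ?case
      by (rule computesI[OF prog_length(13)]) (simp add: prog_nth valid_body_def)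
  next
    case (Cons s ss)
    show ?case
      apply (rule computesI[OF prog_length(13)])
      apply (simp add: prog_nth valid_body_def split del: if_split)
      apply (rule callI[OF computes_sorted[where N = N]])
        apply (simp_all add: Cons.prems assms)
      apply (intro conjI impI; rule callI[OF Cons.IH])
      apply (simp_all add: Cons.prems)
      done
  qed
  then show ?thesis
    by (rule computes_mono) (use assms in \<open>simp add: c_valid_def\<close>)
qed

section \<open>Trie operations\<close>

text \<open>The stack holds values rather than objects to be encoded, hence the identity encoding of
  its elements. The cost is a constant for each node of the stack, counted as in the termination
  measure.\<close>

lemma computes_tinsert:
  "computes colouring_prog f_tinsert [enc_list (\<lambda>x. x) st, tr] (trie_insert st tr)
     (40 * (\<Sum>x\<leftarrow>st. 2 * size x + 1) + 20)"
proof (induction st tr rule: trie_insert.induct)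
  case (1 tr)
  show ?case
    by (rule computesI[OF prog_length(14)]) (simp add: prog_nth tinsert_body_def)
next
  case (2 st tr)
  show ?case
    apply (rule computesI[OF prog_length(14)])
    apply (simp add: prog_nth tinsert_body_def)
    apply (rule callI[OF 2])
    apply simp
    done
next
  case (3 a b st tr)
  show ?case
    apply (rule computesI[OF prog_length(14)])
    apply (simp add: prog_nth tinsert_body_def)
    apply (rule callI[OF 3[unfolded enc_list.simps]])
    apply simp
    done
qed

lemma computes_tmember:
  "computes colouring_prog f_tmember [enc_list (\<lambda>x. x) st, tr] (enc_bool (trie_member st tr))
     (40 * (\<Sum>x\<leftarrow>st. 2 * size x + 1) + 20)"
proof (induction st tr rule: trie_member.induct)
  case (1 tr)
  show ?case
    by (rule computesI[OF prog_length(15)]) (simp add: prog_nth tmember_body_def)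
next
  case (2 st tr)
  show ?case
    apply (rule computesI[OF prog_length(15)])
    apply (simp add: prog_nth tmember_body_def)
    apply (rule callI[OF 2])
    apply simp
    done
next
  case (3 a b st tr)
  show ?case
    apply (rule computesI[OF prog_length(15)])
    apply (simp add: prog_nth tmember_body_def)
    apply (rule callI[OF 3[unfolded enc_list.simps]])
    apply simp
    done
qed

lemma computes_tinsert_state:
  assumes "small N s"
  shows "computes colouring_prog f_tinsert [Pr (enc_list enc_arc s) Nl, tr]
           (trie_insert [enc_list enc_arc s] tr) (c_tinsert N)"
  using computes_tinsert[of "[enc_list enc_arc s]" tr, unfolded enc_list.simps]
  by (rule computes_mono) (use size_enc_state[OF assms] in \<open>simp add: c_tinsert_def\<close>)

lemma computes_tmember_state:
  assumes "small N s"
  shows "computes colouring_prog f_tmember [Pr (enc_list enc_arc s) Nl, tr]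
           (enc_bool (trie_member [enc_list enc_arc s] tr)) (c_tinsert N)"
  using computes_tmember[of "[enc_list enc_arc s]" tr, unfolded enc_list.simps]
  by (rule computes_mono) (use size_enc_state[OF assms] in \<open>simp add: c_tinsert_def\<close>)

lemma computes_trie:
  assumes "\<And>s. s \<in> set ss \<Longrightarrow> small N s" "length b \<le> N" "length ss \<le> W"
  shows "computes colouring_prog f_trie [enc_list enc_nat b, enc_list (enc_list enc_arc) ss]
           (trie_of (map (\<lambda>s. enc_list enc_arc (restr b s)) ss)) (c_trie N W)"
proof -
  have "computes colouring_prog f_trie [enc_list enc_nat b, enc_list (enc_list enc_arc) ss]
           (trie_of (map (\<lambda>s. enc_list enc_arc (restr b s)) ss))
           (length ss * (c_restr N + c_tinsert N + 60) + 20)"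
    using assms(1)
  proof (induction ss)
    case Nil
    show ?case
      by (rule computesI[OF prog_length(16)]) (simp add: prog_nth trie_body_def trie_of_def)
  next
    case (Cons s ss)
    show ?case
      apply (rule computesI[OF prog_length(16)])
      apply (simp add: prog_nth trie_body_def)
      apply (rule callI[OF computes_restr[where N = N]])
        apply (simp_all add: Cons.prems assms)
      apply (rule callI[OF Cons.IH])
       apply (simp_all add: Cons.prems)
      apply (rule callI[OF computes_tinsert_state[where N = N]])
       apply (simp_all add: Cons.prems small_restr trie_of_def)
      done
  qed
  then show ?thesis
    by (rule computes_mono) (use assms in \<open>simp add: c_trie_def\<close>)
qed

lemma computes_filter:
  assumes "\<And>s. s \<in> set ss \<Longrightarrow> small N s" "length b \<le> N" "length ss \<le> W"
  shows "computes colouring_prog f_filter [enc_list enc_nat b, tr, enc_list (enc_list enc_arc) ss]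
           (enc_list (enc_list enc_arc)
             (filter (\<lambda>s. trie_member [enc_list enc_arc (restr b s)] tr) ss)) (c_trie N W)"
proof -
  have "computes colouring_prog f_filter [enc_list enc_nat b, tr, enc_list (enc_list enc_arc) ss]
           (enc_list (enc_list enc_arc)
             (filter (\<lambda>s. trie_member [enc_list enc_arc (restr b s)] tr) ss))
           (length ss * (c_restr N + c_tinsert N + 60) + 20)"
    using assms(1)
  proof (induction ss)
    case Nil
    show ?case
      by (rule computesI[OF prog_length(17)]) (simp add: prog_nth filter_body_def)
  next
    case (Cons s ss)
    show ?case
      apply (rule computesI[OF prog_length(17)])
      apply (simp add: prog_nth filter_body_def split del: if_split)
      apply (rule callI[OF computes_restr[where N = N]])
        apply (simp_all add: Cons.prems assms split del: if_split)
      apply (rule callI[OF computes_tmember_state[where N = N]])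
       apply (simp_all add: Cons.prems small_restr)
      apply (intro conjI impI; rule callI[OF Cons.IH])
      apply (simp_all add: Cons.prems)
      done
  qed
  then show ?thesis
    by (rule computes_mono) (use assms in \<open>simp add: c_trie_def\<close>)
qed

section \<open>Node tables and rounds of arc consistency\<close>

definition enc_node :: "nat list list \<Rightarrow> (nat \<Rightarrow> (nat \<times> nat) list list) \<Rightarrow> nat \<Rightarrow> val" where
  "enc_node bs X i =
     Pr (enc_nat i) (Pr (enc_list enc_nat (bs ! i)) (enc_list (enc_list enc_arc) (X i)))"

lemma enc_node_sel [simp]:
  "val_fst (enc_node bs X i) = enc_nat i"
  "val_fst (val_snd (enc_node bs X i)) = enc_list enc_nat (bs ! i)"
  "val_snd (val_snd (enc_node bs X i)) = enc_list (enc_list enc_arc) (X i)"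
  by (simp_all add: enc_node_def)

definition bounded_tables ::
  "nat \<Rightarrow> nat \<Rightarrow> nat list list \<Rightarrow> (nat \<Rightarrow> (nat \<times> nat) list list) \<Rightarrow> nat \<Rightarrow> bool" where
  "bounded_tables N W bs X i \<longleftrightarrow>
     i \<le> N \<and> length (bs ! i) \<le> N \<and> length (X i) \<le> W \<and> (\<forall>s \<in> set (X i). small N s)"

lemma computes_prune:
  assumes es: "length es \<le> N * N"
    and X: "\<And>j. j \<in> set js \<Longrightarrow> bounded_tables N W bs X j"
    and i: "bounded_tables N W bs X i"
    and js: "length js \<le> N"
  shows "computes colouring_prog f_prune
           [enc_list enc_arc es, enc_nat i, enc_list enc_nat (bs ! i),
            enc_list (enc_node bs X) js, enc_list (enc_list enc_arc) (X i)]
           (enc_list (enc_list enc_arc) (filter (supported es bs X js i) (X i))) (c_prune N W)"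
proof -
  have "computes colouring_prog f_prune
           [enc_list enc_arc es, enc_nat i, enc_list enc_nat (bs ! i),
            enc_list (enc_node bs X) js, enc_list (enc_list enc_arc) (X i)]
           (enc_list (enc_list enc_arc) (filter (supported es bs X js i) (X i)))
           (length js * (c_mem N + 2 * c_trie N W + 100) + 20)"
    using X
  proof (induction js)
    case Nil
    show ?case
      by (rule computesI[OF prog_length(18)]) (simp add: prog_nth prune_body_def supported_def)
  next
    case (Cons j js)
    have j: "bounded_tables N W bs X j" by (simp add: Cons.prems)
    have le: "length (filter P (X i)) \<le> W" for P
      using i le_trans[OF length_filter_le] by (auto simp: bounded_tables_def)
    show ?case
    proof (cases "(i, j) \<in> set es")
      case True
      \<comment> \<open>Since states are encoded injectively, a successful lookup means that
        \<open>j\<close> holds a supporting state. The nested filters mirror the program, which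
        first prunes against \<open>js\<close>; they must not be merged by
        \<open>filter_filter\<close>.\<close>
      have eq: "filter (supported es bs X (j # js) i) (X i) =
          filter (\<lambda>s. trie_member [enc_list enc_arc (restr (bs ! j) s)]
                (trie_of (map (\<lambda>s. enc_list enc_arc (restr (bs ! i) s)) (X j))))
                (filter (supported es bs X js i) (X i))"
        using True
        by (auto simp: supported_def trie_member_trie_of image_iff eq_commute intro!: filter_cong)
      show ?thesis
        unfolding eq
        apply (rule computesI[OF prog_length(18)])
        apply (simp add: prog_nth prune_body_def del: filter_filter)
        apply (rule callI[OF Cons.IH])
         apply (simp add: Cons.prems)
        apply (rule callI[OF computes_mem_arc[where N = N]])
           apply (use i j es in \<open>simp_all add: bounded_tables_def True del: filter_filter\<close>)
        apply (rule callI[OF computes_trie[where N = N and W = W]])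
           apply (simp_all del: filter_filter)
        apply (rule callI[OF computes_filter[where N = N and W = W]])
           apply (simp_all add: le del: filter_filter)
        done
    next
      case False
      have eq: "filter (supported es bs X (j # js) i) (X i) = filter (supported es bs X js i) (X i)"
        using False by (auto simp: supported_def intro!: filter_cong)
      show ?thesis
        unfolding eq
        apply (rule computesI[OF prog_length(18)])
        apply (simp add: prog_nth prune_body_def)
        apply (rule callI[OF Cons.IH])
         apply (simp add: Cons.prems)
        apply (rule callI[OF computes_mem_arc[where N = N]])
           apply (use i j es in \<open>simp_all add: bounded_tables_def False\<close>)
        done
    qed
  qed
  then show ?thesis
    by (rule computes_mono) (use js in \<open>simp add: c_prune_def\<close>)
qed

lemma computes_round:
  assumes es: "length es \<le> N * N"
    and X: "\<And>j. j < m \<Longrightarrow> bounded_tables N W bs X j"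
    and m: "m \<le> N"
  shows "computes colouring_prog f_round
           [enc_list enc_arc es, enc_list (enc_node bs X) [0..<m], enc_list (enc_node bs X) [0..<m]]
           (enc_list (enc_node bs (prune es bs m X)) [0..<m]) (c_round N W)"
proof -
  \<comment> \<open>The induction varies only the traversed list; the list consulted for support
    stays \<open>[0..<m]\<close> with the old tables.\<close>
  have "set is \<subseteq> {0..<m} \<Longrightarrow> computes colouring_prog f_round
           [enc_list enc_arc es, enc_list (enc_node bs X) [0..<m], enc_list (enc_node bs X) is]
           (enc_list (enc_node bs (prune es bs m X)) is) (length is * (c_prune N W + 100) + 20)" for "is"
  proof (induction "is")
    case Nil
    show ?case
      by (rule computesI[OF prog_length(19)]) (simp add: prog_nth round_body_def)
  next
    case (Cons i "is")
    show ?case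
      apply (rule computesI[OF prog_length(19)])
      apply (simp add: prog_nth round_body_def)
      apply (rule callI[OF computes_prune[where N = N and W = W]])
          apply (use es X m Cons.prems in simp_all)
      apply (rule callI[OF Cons.IH])
       apply (simp_all add: enc_node_def[of _ _ i] prune_def[of es bs m X i])
      done
  qed
  from this[of "[0..<m]"] show ?thesis
    by (rule computes_mono[OF _ _]) (use m in \<open>auto simp: c_round_def\<close>)
qed

lemma bounded_tables_prune:
  "bounded_tables N W bs X i \<Longrightarrow> bounded_tables N W bs (prune es bs m X) i"
  using le_trans[OF length_filter_le] by (auto simp: bounded_tables_def prune_def)

lemma computes_iter:
  assumes es: "length es \<le> N * N"
    and X: "\<And>j. j < m \<Longrightarrow> bounded_tables N W bs X j"
    and m: "m \<le> N" and r: "r \<le> N"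
  shows "computes colouring_prog f_iter
           [enc_nat r, enc_list enc_arc es, enc_list (enc_node bs X) [0..<m]]
           (enc_list (enc_node bs ((prune es bs m ^^ r) X)) [0..<m]) (c_iter N W)"
proof -
  have "computes colouring_prog f_iter
           [enc_nat r, enc_list enc_arc es, enc_list (enc_node bs X) [0..<m]]
           (enc_list (enc_node bs ((prune es bs m ^^ r) X)) [0..<m]) (r * (c_round N W + 60) + 20)"
    using X
  proof (induction r arbitrary: X)
    case 0
    show ?case
      by (rule computesI[OF prog_length(20)]) (simp add: prog_nth iter_body_def)
  next
    case (Suc r)
    show ?case
      apply (rule computesI[OF prog_length(20)])
      apply (simp add: prog_nth iter_body_def)
      apply (rule callI[OF computes_round[OF es Suc.prems m]])
       apply assumption
      apply (rule callI[OF Suc.IH])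
       apply (simp_all add: bounded_tables_prune Suc.prems funpow_swap1)
      done
  qed
  then show ?thesis
    by (rule computes_mono) (use r in \<open>simp add: c_iter_def\<close>)
qed

lemma bounded_init_tables:
  assumes "i \<le> N" "distinct (bs ! i)" "\<And>v. v \<in> set (bs ! i) \<Longrightarrow> v \<le> N" "length (bs ! i) \<le> N" "k \<le> N"
    "max 1 k ^ length (bs ! i) * fact (length (bs ! i)) \<le> W"
  shows "bounded_tables N W bs (init_tables as bs k) i" "length (states (bs ! i) k) \<le> W"
proof -
  have "length (states (bs ! i) k) \<le> max 1 k ^ length (bs ! i) * fact (length (bs ! i))"
    unfolding length_states by (intro mult_le_mono1 power_mono) auto
  also have "\<dots> \<le> W" by fact
  finally show W: "length (states (bs ! i) k) \<le> W" .
  then show "bounded_tables N W bs (init_tables as bs k) i"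
    using assms states_small[OF assms(2,3,5,4)] le_trans[OF length_filter_le]
    by (auto simp: bounded_tables_def init_tables_def)
qed

lemma computes_tables:
  assumes as: "length as \<le> N * N" and k: "k \<le> N" and m: "length bs \<le> N"
    and bs: "\<And>i. i < length bs \<Longrightarrow> distinct (bs ! i) \<and> set (bs ! i) \<subseteq> {..N} \<and> length (bs ! i) \<le> N \<and>
      max 1 k ^ length (bs ! i) * fact (length (bs ! i)) \<le> W"
  shows "computes colouring_prog f_tables
           [Nl, enc_list enc_arc as, enc_nat k, enc_list (enc_list enc_nat) bs]
           (enc_list (enc_node bs (init_tables as bs k)) [0..<length bs]) (c_tables N W)"
proof -
  \<comment> \<open>The program counts the index up while it consumes the bags, hence the
    generalisation to suffixes and the induction on the number of remaining bags.\<close>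
  have "i \<le> length bs \<Longrightarrow> computes colouring_prog f_tables
           [enc_nat i, enc_list enc_arc as, enc_nat k, enc_list (enc_list enc_nat) (drop i bs)]
           (enc_list (enc_node bs (init_tables as bs k)) [i..<length bs])
           ((length bs - i) * (c_states N W + c_valid N W + 100) + 20)" for i
  proof (induction "length bs - i" arbitrary: i)
    case 0
    then show ?case
      by (intro computesI[OF prog_length(21)]) (simp add: prog_nth tables_body_def)
  next
    case (Suc d)
    then have i: "i < length bs" by linarith
    have upt: "[i..<length bs] = i # [Suc i..<length bs]" using i by (rule upt_conv_Cons)
    have drop: "drop i bs = bs ! i # drop (Suc i) bs" using i by (simp add: Cons_nth_drop_Suc)
    have len: "length bs - i = Suc (length bs - Suc i)" using i by linarith
    have IH: "computes colouring_prog f_tables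
           [Pr Nl (enc_nat i), enc_list enc_arc as, enc_nat k, enc_list (enc_list enc_nat) (drop (Suc i) bs)]
           (enc_list (enc_node bs (init_tables as bs k)) [Suc i..<length bs])
           ((length bs - Suc i) * (c_states N W + c_valid N W + 100) + 20)"
      using Suc.hyps(1)[of "Suc i"] Suc.hyps(2) i by simp
    show ?case
      unfolding upt drop len
      apply (rule computesI[OF prog_length(21)])
      apply (simp add: prog_nth tables_body_def)
      apply (rule callI[OF computes_states[where N = N and W = W]])
         apply (use bs[OF i] k in simp_all)
      apply (rule callI[OF computes_valid[where N = N and W = W]])
         apply (rule states_small[where b = "bs ! i" and k = k])
             apply (use as in auto)[5]
        apply (rule as)
       apply (rule bounded_init_tables(2)[of i N])
            apply (use m i in auto)[6]
      apply (rule callI[OF IH])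
      apply (simp add: enc_node_def[of _ _ i] init_tables_def)
      done
  qed
  from this[of 0] show ?thesis
    by (simp add: c_tables_def) (erule computes_mono, use m in simp)
qed

text \<open>If \<open>n \<le> k\<close>, the program answers right after the comparison, so
  \<open>W\<close> has to bound table sizes only in the other case. This lets the final proof choose
  \<open>W = 1\<close> there.\<close>

lemma computes_main:
  assumes as: "length as \<le> N * N" and es: "length es \<le> N * N" and n: "n \<le> N"
    and m: "length bs = m" "0 < m" "m \<le> N"
    and bs: "\<And>i. i < m \<Longrightarrow> distinct (bs ! i) \<and> set (bs ! i) \<subseteq> {..N} \<and> length (bs ! i) \<le> N \<and>
      max 1 k ^ length (bs ! i) * fact (length (bs ! i)) \<le> W \<or> n \<le> k"
  shows "\<exists>t \<le> c_main N W. runs colouring_prog (enc_instance n as k m es bs)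
           (enc_bool (n \<le> k \<or> (prune es bs m ^^ m) (init_tables as bs k) 0 \<noteq> [])) t"
proof -
  have enc: "enc_list f xs = Nl \<longleftrightarrow> xs = []" for f :: "'a \<Rightarrow> val" and xs
    by (cases xs) auto
  have bd: "bounded_tables N W bs (init_tables as bs k) j" if "j < m" "\<not> n \<le> k" for j
    by (rule bounded_init_tables) (use that bs[OF that(1)] n m in auto)
  have "wp colouring_prog [enc_instance n as k m es bs] main_body
     (\<lambda>v t. v = enc_bool (n \<le> k \<or> (prune es bs m ^^ m) (init_tables as bs k) 0 \<noteq> []) \<and> t \<le> c_main N W)"
    unfolding main_body_def enc_instance_def enc_digraph_def
    apply simp
    apply (rule callI[OF computes_le])
    apply simp
    apply (intro conjI impI)
     prefer 2
     apply (use n in \<open>simp add: c_main_def\<close>)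
    apply (rule callI[OF computes_tables[where N = N and W = W]])
        apply (use as n m bs in auto)[4]
    apply (unfold m(1))
    apply (rule callI[OF computes_iter[where N = N and W = W, OF es bd]])
        apply (use m in auto)[4]
    apply (use m n in \<open>simp add: upt_conv_Cons enc c_main_def\<close>)
    done
  then show ?thesis
    unfolding runs_def wp_def prog_nth by (auto simp: colouring_prog_def)
qed

section \<open>Polynomial bounds\<close>

text \<open>\<open>W\<close> stands for the exponential factor, so its exponent is fixed at 1 while
  the degree in \<open>N\<close> is free. For arguments at least 1, lower powers of \<open>N\<close>
  and missing factors \<open>W\<close> are absorbed, which gives closure under sums.\<close>

definition lin_bounded :: "(nat \<Rightarrow> nat \<Rightarrow> nat) \<Rightarrow> bool" where
  "lin_bounded f \<longleftrightarrow> (\<exists>c d. \<forall>N \<ge> 1. \<forall>W \<ge> 1. f N W \<le> c * N ^ d * W)"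

definition poly_bounded :: "(nat \<Rightarrow> nat) \<Rightarrow> bool" where
  "poly_bounded f \<longleftrightarrow> (\<exists>c d. \<forall>N \<ge> 1. f N \<le> c * N ^ d)"

lemma poly_bounded_const: "poly_bounded (\<lambda>N. a)"
  unfolding poly_bounded_def by (intro exI[of _ a] exI[of _ 0]) simp

lemma poly_bounded_id: "poly_bounded (\<lambda>N. N)"
  unfolding poly_bounded_def by (intro exI[of _ 1]) simp

lemma poly_bounded_mult:
  assumes "poly_bounded f" "poly_bounded g"
  shows "poly_bounded (\<lambda>N. f N * g N)"
proof -
  obtain c d c' d' where "\<forall>N \<ge> 1. f N \<le> c * N ^ d" "\<forall>N \<ge> 1. g N \<le> c' * N ^ d'"
    using assms unfolding poly_bounded_def by blast
  then have "f N * g N \<le> (c * c') * N ^ (d + d')" if "N \<ge> 1" for N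
    using mult_le_mono[of "f N" "c * N ^ d" "g N" "c' * N ^ d'"] that
    by (simp add: power_add mult.assoc mult.left_commute)
  then show ?thesis unfolding poly_bounded_def by blast
qed

lemma lin_bounded_add:
  assumes "lin_bounded f" "lin_bounded g"
  shows "lin_bounded (\<lambda>N W. f N W + g N W)"
proof -
  obtain c d c' d' where *: "\<forall>N \<ge> 1. \<forall>W \<ge> 1. f N W \<le> c * N ^ d * W"
    "\<forall>N \<ge> 1. \<forall>W \<ge> 1. g N W \<le> c' * N ^ d' * W"
    using assms unfolding lin_bounded_def by blast
  have "f N W + g N W \<le> (c + c') * N ^ (d + d') * W" if "N \<ge> 1" "W \<ge> 1" for N W
  proof -
    have "f N W \<le> c * N ^ d * W" using * that by blast
    also have "\<dots> \<le> c * N ^ (d + d') * W"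
      by (intro mult_le_mono power_increasing) (use that in auto)
    finally have f: "f N W \<le> c * N ^ (d + d') * W" .
    have "g N W \<le> c' * N ^ d' * W" using * that by blast
    also have "\<dots> \<le> c' * N ^ (d + d') * W"
      by (intro mult_le_mono power_increasing) (use that in auto)
    finally show ?thesis using f by (simp add: algebra_simps)
  qed
  then show ?thesis unfolding lin_bounded_def by blast
qed

lemma lin_bounded_mult:
  assumes "poly_bounded f" "lin_bounded g"
  shows "lin_bounded (\<lambda>N W. f N * g N W)"
proof -
  obtain c d c' d' where *: "\<forall>N \<ge> 1. f N \<le> c * N ^ d"
    "\<forall>N \<ge> 1. \<forall>W \<ge> 1. g N W \<le> c' * N ^ d' * W"
    using assms unfolding lin_bounded_def poly_bounded_def by blast
  then have "f N * g N W \<le> (c * c') * N ^ (d + d') * W" if "N \<ge> 1" "W \<ge> 1" for N W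
    using mult_le_mono[of "f N" "c * N ^ d" "g N W" "c' * N ^ d' * W"] that
    by (simp add: power_add mult.assoc mult.left_commute)
  then show ?thesis unfolding lin_bounded_def by blast
qed

lemma lin_bounded_poly:
  assumes "poly_bounded f"
  shows "lin_bounded (\<lambda>N W. f N)" "lin_bounded (\<lambda>N W. W * f N)"
proof -
  obtain c d where *: "\<forall>N \<ge> 1. f N \<le> c * N ^ d"
    using assms unfolding poly_bounded_def by blast
  have "f N \<le> c * N ^ d * W" if "N \<ge> 1" "W \<ge> 1" for N W
    using mult_le_mono[of "f N" "c * N ^ d" 1 W] * that by simp
  then show "lin_bounded (\<lambda>N W. f N)" unfolding lin_bounded_def by blast
  have "W * f N \<le> c * N ^ d * W" if "N \<ge> 1" for N W
    using mult_le_mono2[of "f N" "c * N ^ d" W] * that by (simp add: mult.commute)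
  then show "lin_bounded (\<lambda>N W. W * f N)" unfolding lin_bounded_def by blast
qed

lemma poly_bounded_add:
  assumes "poly_bounded f" "poly_bounded g"
  shows "poly_bounded (\<lambda>N. f N + g N)"
proof -
  have "lin_bounded (\<lambda>N W. f N + g N)"
    using assms by (intro lin_bounded_add lin_bounded_poly)
  then show ?thesis
    unfolding lin_bounded_def poly_bounded_def by (metis mult.right_neutral order_refl)
qed

lemmas bounded_intros = poly_bounded_const poly_bounded_id poly_bounded_mult poly_bounded_add
  lin_bounded_add lin_bounded_mult lin_bounded_poly

text \<open>\<open>W\<close> enters only in \<open>c_extend\<close>, \<open>c_valid\<close> and
  \<open>c_trie\<close>, each time as a factor beside a polynomial in \<open>N\<close>. All other
  bounds add such terms or multiply them by polynomials in \<open>N\<close>, never by one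
  another.\<close>

lemma lin_bounded_main: "lin_bounded c_main"
  unfolding c_main_def c_iter_def c_tables_def c_round_def c_prune_def c_trie_def c_tinsert_def
    c_valid_def c_states_def c_extend_def c_cinserts_def c_inserts_def c_sorted_def c_forward_def
    c_restr_def c_mem_def
  apply (rule lin_bounded_add lin_bounded_poly(2) lin_bounded_poly(1) | rule bounded_intros)+
  done

section \<open>Trees\<close>

text \<open>Trees as they arise by attaching leaves, in place of connectedness without cycles: rule
  induction removes a leaf \<open>w\<close> whose only neighbour in \<open>S\<close> is
  \<open>p\<close>. Both arc consistency and gluing run along this induction.\<close>

inductive grown :: "('t \<times> 't) set \<Rightarrow> 't set \<Rightarrow> bool" for E where
  grown_root: "grown E {r}"
| grown_leaf: "grown E S \<Longrightarrow> w \<notin> S \<Longrightarrow> p \<in> S \<Longrightarrow> (p, w) \<in> E \<Longrightarrow> (\<And>u. u \<in> S \<Longrightarrow> (u, w) \<in> E \<Longrightarrow> u = p)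
    \<Longrightarrow> grown E (insert w S)"

lemma grown_finite: "grown E S \<Longrightarrow> finite S"
  by (induction rule: grown.induct) auto

text \<open>The path stays inside \<open>S\<close>, so two edges from its ends to a node outside
  \<open>S\<close> close it to a cycle; this is how \<open>grown_undirected_tree\<close> uses
  it.\<close>

lemma (in pair_graph) grown_path:
  assumes "grown (parcs G) S" "S \<subseteq> pverts G" "u \<in> S" "v \<in> S"
  shows "\<exists>q. awalk u q v \<and> distinct (pawalk_verts u q) \<and> set (pawalk_verts u q) \<subseteq> S"
  using assms
proof (induction arbitrary: u v rule: grown.induct)
  case (grown_root r)
  then show ?case by (intro exI[of _ "[]"]) (auto simp: awalk_Nil_iff)
next
  case (grown_leaf S w p)
  have wp: "(w, p) \<in> parcs G" using grown_leaf.hyps(4) arcs_symmetric by blast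
  consider "u \<in> S" "v \<in> S" | "u = w" "v = w" | "u = w" "v \<in> S" | "u \<in> S" "v = w"
    using grown_leaf.prems by blast
  then show ?case
  proof cases
    case 1
    then show ?thesis using grown_leaf.IH[of u v] grown_leaf.prems(1) by blast
  next
    case 2
    then show ?thesis using grown_leaf.prems by (intro exI[of _ "[]"]) (auto simp: awalk_Nil_iff)
  next
    case 3
    then obtain q where q: "awalk p q v" "distinct (pawalk_verts p q)" "set (pawalk_verts p q) \<subseteq> S"
      using grown_leaf.IH[of p v] grown_leaf.prems(1) grown_leaf.hyps(3) by blast
    have "awalk u ((w, p) # q) v" using q(1) wp 3 by (simp add: awalk_Cons_iff)
    moreover have "distinct (pawalk_verts u ((w, p) # q))" "set (pawalk_verts u ((w, p) # q)) \<subseteq> insert w S"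
      using q grown_leaf.hyps(2) by auto
    ultimately show ?thesis by blast
  next
    case 4
    then obtain q where q: "awalk u q p" "distinct (pawalk_verts u q)" "set (pawalk_verts u q) \<subseteq> S"
      using grown_leaf.IH[of u p] grown_leaf.prems(1) grown_leaf.hyps(3) by blast
    have w: "awalk u (q @ [(p, w)]) v"
      using q(1) grown_leaf.hyps(4) grown_leaf.prems(1) 4 by (auto simp: awalk_append_iff awalk_simps)
    then have "pawalk_verts u (q @ [(p, w)]) = pawalk_verts u q @ [w]"
      using awalk_verts_append[OF w] by simp
    with q grown_leaf.hyps(2) w show ?thesis by (intro exI[of _ "q @ [(p, w)]"]) auto
  qed
qed

text \<open>A maximal grown set is everything: otherwise connectedness gives an edge from some
  \<open>p\<close> in it to an outside node \<open>w\<close>. A second neighbour of \<open>w\<close>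
  in the set would close a cycle through \<open>w\<close>, so \<open>w\<close> can be attached as a
  leaf, against maximality.\<close>

lemma grown_undirected_tree:
  assumes "undirected_tree T"
  shows "grown (parcs T) (pverts T)"
proof -
  interpret pair_graph T using assms by (simp add: undirected_tree_def)
  have "strongly_connected (with_proj (mk_symmetric (with_proj T)))"
    and no_cycle: "\<And>q. cycle q \<Longrightarrow> \<not> 3 \<le> length q"
    using assms by (auto simp: undirected_tree_def Digraph_Component.connected_def)
  then have ne: "pverts T \<noteq> {}"
    and reach: "\<And>u v. u \<in> pverts T \<Longrightarrow> v \<in> pverts T \<Longrightarrow> (u, v) \<in> rtrancl_on (pverts T) (parcs T)"
    using adj_mk_symmetric_eq[OF sym_arcs] by (auto simp: strongly_connected_def reachable_def)
  define F where "F = {S. S \<subseteq> pverts T \<and> grown (parcs T) S}"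
  have fin: "finite F" unfolding F_def by simp
  obtain r where "r \<in> pverts T" using ne by blast
  then have "{r} \<in> F" by (simp add: F_def grown_root)
  then obtain S where S: "S \<in> F" and max: "\<And>S'. S' \<in> F \<Longrightarrow> S \<subseteq> S' \<Longrightarrow> S = S'"
    using finite_has_maximal[OF fin] by blast
  have SV: "S \<subseteq> pverts T" and gS: "grown (parcs T) S" using S by (auto simp: F_def)
  have "S \<noteq> {}" using gS by (induction rule: grown.induct) auto
  then obtain x where x: "x \<in> S" by blast
  have "S = pverts T"
  proof (rule ccontr)
    assume "S \<noteq> pverts T"
    then obtain y where y: "y \<in> pverts T" "y \<notin> S" using SV by blast
    have "z \<in> S \<or> (\<exists>p w. p \<in> S \<and> w \<notin> S \<and> (p, w) \<in> parcs T)"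
      if "(x, z) \<in> rtrancl_on (pverts T) (parcs T)" for z
      using that by (induction rule: rtrancl_on_induct) (use x in auto)
    from this[OF reach[of x y]] x y SV obtain p w where pw: "p \<in> S" "w \<notin> S" "(p, w) \<in> parcs T"
      by blast
    have wV: "w \<in> pverts T" using pw(3) arc_snd_in_verts by force
    have unique: "u = p" if u: "u \<in> S" "(u, w) \<in> parcs T" for u
    proof (rule ccontr)
      assume "u \<noteq> p"
      obtain q where q: "awalk p q u" "distinct (pawalk_verts p q)" "set (pawalk_verts p q) \<subseteq> S"
        using grown_path[OF gS SV pw(1) u(1)] by blast
      have "q \<noteq> []" using q(1) \<open>u \<noteq> p\<close> by (auto simp: awalk_Nil_iff)
      have wp: "(w, p) \<in> parcs T" using pw(3) arcs_symmetric by blast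
      define c where "c = (w, p) # q @ [(u, w)]"
      have qw: "awalk p (q @ [(u, w)]) w"
        using q(1) u(2) wV by (auto simp: awalk_append_iff awalk_simps)
      have "awalk w c w" using qw wp by (simp add: c_def awalk_Cons_iff del: awalk_append_iff)
      moreover have "pawalk_verts w c = w # pawalk_verts p q @ [w]"
        using awalk_verts_append[OF qw] by (simp add: c_def)
      ultimately have "cycle c"
        unfolding cycle_def using q pw(2) by (intro exI[of _ w]) (auto simp: c_def)
      \<comment> \<open>\<open>u \<noteq> p\<close> gives \<open>q\<close> at least one arc; with
        the two arcs at \<open>w\<close> there are three, so this is more than the digon that every
        edge forms.\<close>
      moreover have "3 \<le> length c" using \<open>q \<noteq> []\<close> by (cases q) (auto simp: c_def)
      ultimately show False using no_cycle by blast
    qed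
    have "grown (parcs T) (insert w S)" by (rule grown_leaf[OF gS pw(2,1,3) unique])
    then have "insert w S \<in> F" using SV wV by (simp add: F_def)
    from max[OF this] pw(2) show False by blast
  qed
  then show ?thesis using gS by simp
qed

section \<open>Arc consistency on grown trees\<close>

lemma prune_iff:
  "s \<in> set (prune es bs m X i) \<longleftrightarrow> s \<in> set (X i) \<and> (\<forall>j < m. (i, j) \<in> set es \<longrightarrow>
     (\<exists>s' \<in> set (X j). restr (bs ! i) s' = restr (bs ! j) s))"
  by (auto simp: prune_def supported_def)

text \<open>
  One round of pruning per node suffices: the first round makes the neighbour of a leaf consistent
  with the leaf, which may then be removed.
\<close>

lemma prune_consistent:
  assumes "grown (set es) S" "S \<subseteq> {..<m}" "t \<in> S" "s \<in> set ((prune es bs m ^^ card S) X t)"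
    and sym: "\<And>u v. (u, v) \<in> set es \<Longrightarrow> (v, u) \<in> set es \<and> u \<noteq> v"
  shows "\<exists>a. a t = s \<and> (\<forall>u \<in> S. a u \<in> set (X u)) \<and>
    (\<forall>u \<in> S. \<forall>v \<in> S. (u, v) \<in> set es \<longrightarrow> restr (bs ! u) (a v) = restr (bs ! v) (a u))"
  using assms(1-4)
proof (induction arbitrary: t s X rule: grown.induct)
  case (grown_root r)
  then show ?case using sym by (intro exI[of _ "\<lambda>_. s"]) (auto simp: prune_iff)
next
  case (grown_leaf S w p)
  have card: "card (insert w S) = Suc (card S)"
    using grown_leaf.hyps by (simp add: grown_finite)
  have edge: "u = p" if "u \<in> S" "(u, w) \<in> set es \<or> (w, u) \<in> set es" for u
    using that grown_leaf.hyps(5) sym by blast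
  show ?case
  proof (cases "t = w")
    case False
    \<comment> \<open>The innermost round is peeled off: the induction hypothesis is applied to the
      tables \<open>prune es bs m X\<close>, so the state chosen at \<open>p\<close> has a partner
      in the table \<open>X w\<close>.\<close>
    then have "t \<in> S" "s \<in> set ((prune es bs m ^^ card S) (prune es bs m X) t)"
      using grown_leaf.prems by (auto simp: card funpow_swap1)
    then obtain a where a: "a t = s" "\<forall>u \<in> S. a u \<in> set (prune es bs m X u)"
      "\<forall>u \<in> S. \<forall>v \<in> S. (u, v) \<in> set es \<longrightarrow> restr (bs ! u) (a v) = restr (bs ! v) (a u)"
      using grown_leaf.IH[of t s "prune es bs m X"] grown_leaf.prems(1) by auto
    have "a p \<in> set (prune es bs m X p)" "w < m"
      using a(2) grown_leaf.hyps(3) grown_leaf.prems(1) by auto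
    then obtain s' where s': "s' \<in> set (X w)" "restr (bs ! p) s' = restr (bs ! w) (a p)"
      using grown_leaf.hyps(4) unfolding prune_iff by blast
    show ?thesis
    proof (intro exI[of _ "a(w := s')"] conjI ballI impI)
      fix u v assume "u \<in> insert w S" "v \<in> insert w S" "(u, v) \<in> set es"
      then show "restr (bs ! u) ((a(w := s')) v) = restr (bs ! v) ((a(w := s')) u)"
        using a(3) s'(2) edge[of u] edge[of v] sym[of u v] grown_leaf.hyps(2)
        by (auto simp: fun_upd_def)
    qed (use a s' False in \<open>auto simp: prune_iff\<close>)
  next
    case True
    \<comment> \<open>For the leaf itself the outermost round is peeled off instead. It provides
      \<open>s\<close> with a partner \<open>s'\<close> at \<open>p\<close>, where the induction
      hypothesis starts with the tables \<open>X\<close>.\<close>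
    then have "s \<in> set (prune es bs m ((prune es bs m ^^ card S) X) w)"
      using grown_leaf.prems by (simp add: card)
    then obtain s' where s: "s \<in> set ((prune es bs m ^^ card S) X w)"
      "s' \<in> set ((prune es bs m ^^ card S) X p)" "restr (bs ! w) s' = restr (bs ! p) s"
      using grown_leaf.hyps(3,4) grown_leaf.prems(1) sym by (auto simp: prune_iff)
    obtain a where a: "a p = s'" "\<forall>u \<in> S. a u \<in> set (X u)"
      "\<forall>u \<in> S. \<forall>v \<in> S. (u, v) \<in> set es \<longrightarrow> restr (bs ! u) (a v) = restr (bs ! v) (a u)"
      using grown_leaf.IH[OF _ grown_leaf.hyps(3) s(2)] grown_leaf.prems(1) by auto
    have "s \<in> set ((prune es bs m ^^ r) X w) \<Longrightarrow> s \<in> set (X w)" for r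
      by (induction r) (auto simp: prune_iff)
    then have sX: "s \<in> set (X w)" using s(1) .
    show ?thesis
    proof (intro exI[of _ "a(w := s)"] conjI ballI impI)
      fix u v assume "u \<in> insert w S" "v \<in> insert w S" "(u, v) \<in> set es"
      then show "restr (bs ! u) ((a(w := s)) v) = restr (bs ! v) ((a(w := s)) u)"
        using a(1,3) s(3) edge[of u] edge[of v] sym[of u v] grown_leaf.hyps(2)
        by (auto simp: fun_upd_def)
    qed (use a sX True in auto)
  qed
qed

section \<open>Gluing\<close>

text \<open>The entries satisfying both predicates form the same subsequence of \<open>xs\<close>
  and \<open>ys\<close>. It cuts both lists into blocks, and blocks between the same two common
  entries can be written one after the other.\<close>

lemma amalgamate_lists:
  assumes "\<forall>x \<in> set xs. P x" "\<forall>y \<in> set ys. Q y" "filter Q xs = filter P ys"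
  shows "\<exists>zs. filter P zs = xs \<and> filter Q zs = ys \<and> set zs = set xs \<union> set ys"
  using assms
proof (induction xs arbitrary: ys)
  case Nil
  then show ?case by (intro exI[of _ ys]) auto
next
  case (Cons x xs)
  show ?case
  proof (cases "Q x")
    case False
    then obtain zs where "filter P zs = xs \<and> filter Q zs = ys \<and> set zs = set xs \<union> set ys"
      using Cons.IH[of ys] Cons.prems by auto
    then show ?thesis using False Cons.prems by (intro exI[of _ "x # zs"]) auto
  next
    case True
    then have "filter P ys = x # filter Q xs" using Cons.prems by simp
    then obtain ys1 ys2 where ys: "ys = ys1 @ x # ys2" "\<forall>y \<in> set ys1. \<not> P y" "filter Q xs = filter P ys2"
      by (auto simp: filter_eq_Cons_iff)
    then obtain zs where "filter P zs = xs \<and> filter Q zs = ys2 \<and> set zs = set xs \<union> set ys2"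
      using Cons.IH[of ys2] Cons.prems by auto
    then show ?thesis using True ys Cons.prems by (intro exI[of _ "ys1 @ x # zs"]) auto
  qed
qed

text \<open>Connectedness of the subgraph induced on \<open>A\<close>. The empty set is linked,
  unlike with the library notion; this matters when removing leaves leaves a vertex without
  bags.\<close>

definition linked :: "('t \<times> 't) set \<Rightarrow> 't set \<Rightarrow> bool" where
  "linked E A \<longleftrightarrow> (\<forall>x \<in> A. \<forall>y \<in> A. (x, y) \<in> (E \<inter> A \<times> A)\<^sup>*)"

text \<open>A walk inside \<open>A\<close> enters and leaves the leaf \<open>w\<close> through
  \<open>p\<close> only, so \<open>w\<close> can be cut out of it.\<close>

lemma linked_leaf:
  assumes "linked E A" "A \<subseteq> insert w S" "w \<notin> S"
    and leaf: "\<And>u. u \<in> S \<Longrightarrow> (u, w) \<in> E \<or> (w, u) \<in> E \<Longrightarrow> u = p" and "(w, w) \<notin> E"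
  shows "linked E (A - {w})" "w \<in> A \<Longrightarrow> x \<in> A \<Longrightarrow> x \<noteq> w \<Longrightarrow> p \<in> A"
proof -
  let ?R = "E \<inter> A \<times> A" and ?R' = "E \<inter> (A - {w}) \<times> (A - {w})"
  \<comment> \<open>Invariant along the walk: while it is at \<open>w\<close>, it has come from
    \<open>p\<close>, so a walk to \<open>p\<close> avoiding \<open>w\<close> is remembered
    instead.\<close>
  have bypass: "(if y = w then (x, p) \<in> ?R'\<^sup>* else (x, y) \<in> ?R'\<^sup>*)" if "(x, y) \<in> ?R\<^sup>*" "x \<noteq> w" for x y
    using that(1)
  proof (induction rule: rtrancl_induct)
    case base
    then show ?case using that by simp
  next
    case (step y z)
    consider "y \<noteq> w" "z \<noteq> w" | "y \<noteq> w" "z = w" | "y = w" "z \<noteq> w" | "y = w" "z = w" by blast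
    then show ?case
    proof cases
      case 1
      then have "(y, z) \<in> ?R'" using step.hyps by blast
      with 1 step.IH show ?thesis by (simp add: rtrancl.rtrancl_into_rtrancl)
    next
      case 2
      then have "y = p" using step.hyps leaf[of y] assms(2) by blast
      with 2 step.IH show ?thesis by simp
    next
      case 3
      then have "z = p" using step.hyps leaf[of z] assms(2) by blast
      with 3 step.IH show ?thesis by simp
    next
      case 4
      then show ?thesis using step.hyps assms(5) by blast
    qed
  qed
  show "linked E (A - {w})"
    unfolding linked_def
  proof (intro ballI)
    fix x y assume xy: "x \<in> A - {w}" "y \<in> A - {w}"
    then have "(x, y) \<in> ?R\<^sup>*" using assms(1) by (simp add: linked_def)
    from bypass[OF this] xy show "(x, y) \<in> ?R'\<^sup>*" by simp
  qed
  show "p \<in> A" if wx: "w \<in> A" "x \<in> A" "x \<noteq> w"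
  proof -
    have "(x, w) \<in> ?R\<^sup>*" using assms(1) wx by (simp add: linked_def)
    then obtain y where "(y, w) \<in> ?R" using wx(3) by (metis rtranclE)
    then show ?thesis using leaf[of y] assms(2,5) by blast
  qed
qed

text \<open>A vertex that the leaf bag shares with any earlier bag also lies in the bag of the
  parent \<open>p\<close>, because its bags are linked. Hence agreement of \<open>a w\<close> with
  \<open>a p\<close> is already agreement with the whole list glued so far, and
  \<open>amalgamate_lists\<close> applies.\<close>

lemma glue_states:
  assumes "grown E S"
    and sym: "\<And>u v. (u, v) \<in> E \<Longrightarrow> (v, u) \<in> E \<and> u \<noteq> v"
    and "\<And>v. linked E {t \<in> S. v \<in> set (bs ! t)}"
    and "\<And>t. t \<in> S \<Longrightarrow> fst ` set (a t) = set (bs ! t)"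
    and "\<And>u v. u \<in> S \<Longrightarrow> v \<in> S \<Longrightarrow> (u, v) \<in> E \<Longrightarrow> restr (bs ! u) (a v) = restr (bs ! v) (a u)"
  shows "\<exists>L. set L = (\<Union>t \<in> S. set (a t)) \<and> (\<forall>t \<in> S. restr (bs ! t) L = a t)"
  using assms(1,3-5)
proof (induction rule: grown.induct)
  case (grown_root r)
  have "restr (bs ! r) (a r) = a r"
    unfolding restr_def using grown_root(2)[of r] by (intro filter_True) auto
  then show ?case by (intro exI[of _ "a r"]) simp
next
  case (grown_leaf S w p)
  note hyps = grown_leaf.hyps and prems = grown_leaf.prems
  have leaf: "u = p" if "u \<in> S" "(u, w) \<in> E \<or> (w, u) \<in> E" for u
    using that hyps(5) sym by blast
  have irr: "(w, w) \<notin> E" using sym by blast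
  define A where "A v = {t \<in> insert w S. v \<in> set (bs ! t)}" for v
  have A: "linked E (A v)" "A v \<subseteq> insert w S" for v
    using prems(1)[of v] by (auto simp: A_def)
  have "{t \<in> S. v \<in> set (bs ! t)} = A v - {w}" for v
    using hyps(2) by (auto simp: A_def)
  then have linkS: "linked E {t \<in> S. v \<in> set (bs ! t)}" for v
    using linked_leaf(1)[OF A hyps(2) leaf irr] by simp
  have "\<exists>L. set L = (\<Union>t \<in> S. set (a t)) \<and> (\<forall>t \<in> S. restr (bs ! t) L = a t)"
    by (rule grown_leaf.IH[OF linkS prems(2) prems(3)]) auto
  then obtain L where L: "set L = (\<Union>t \<in> S. set (a t))" "\<forall>t \<in> S. restr (bs ! t) L = a t"
    by blast
  have inter: "v \<in> set (bs ! p)" if "v \<in> set (bs ! w)" "t \<in> S" "v \<in> set (bs ! t)" for v t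
    using linked_leaf(2)[OF A hyps(2) leaf irr, of v t] that hyps(2) by (auto simp: A_def)
  define U where "U = (\<Union>t \<in> S. set (bs ! t))"
  have fstL: "fst x \<in> U" if "x \<in> set L" for x
  proof -
    obtain t where "t \<in> S" "x \<in> set (a t)" using \<open>x \<in> set L\<close> L(1) by auto
    then have "fst x \<in> fst ` set (a t)" by blast
    then show ?thesis using prems(2)[of t] \<open>t \<in> S\<close> by (auto simp: U_def)
  qed
  have fstw: "fst x \<in> set (bs ! w)" if "x \<in> set (a w)" for x
    using prems(2)[of w] that by (metis imageI insertI1)
  have "filter (\<lambda>x. fst x \<in> set (bs ! w)) L = restr (bs ! w) (restr (bs ! p) L)"
    unfolding restr_def filter_filter using fstL inter by (auto simp: U_def intro!: filter_cong)
  also have "\<dots> = restr (bs ! p) (a w)"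
    using L(2) hyps(3,4) prems(3)[of p w] by simp
  also have "\<dots> = filter (\<lambda>x. fst x \<in> U) (a w)"
    unfolding restr_def using fstw inter hyps(3) by (auto simp: U_def intro!: filter_cong)
  finally have "filter (\<lambda>x. fst x \<in> set (bs ! w)) L = filter (\<lambda>x. fst x \<in> U) (a w)" .
  then obtain Z where Z: "filter (\<lambda>x. fst x \<in> U) Z = L" "filter (\<lambda>x. fst x \<in> set (bs ! w)) Z = a w"
    "set Z = set L \<union> set (a w)"
    using amalgamate_lists[of L "\<lambda>x. fst x \<in> U" "a w" "\<lambda>x. fst x \<in> set (bs ! w)"] fstL fstw by blast
  have "restr (bs ! t) Z = a t" if "t \<in> S" for t
  proof -
    \<comment> \<open>Every vertex of the bag of \<open>t\<close> is in \<open>U\<close>, so the new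
      list restricted to this bag sees only the entries of \<open>L\<close>.\<close>
    have "restr (bs ! t) Z = restr (bs ! t) (filter (\<lambda>x. fst x \<in> U) Z)"
      unfolding restr_def filter_filter using that by (auto simp: U_def intro!: filter_cong)
    then show ?thesis using L(2) Z(1) that by simp
  qed
  then show ?case using Z L(1) by (intro exI[of _ Z]) (auto simp: restr_def)
qed

text \<open>Sortedness is a condition on pairs, so it suffices that each pair which could violate it
  survives together in one of the filtered lists.\<close>

lemma sorted_wrt_if_filters:
  assumes "\<And>t. t \<in> S \<Longrightarrow> sorted_wrt P (filter (Q t) L)"
    and "\<And>x y. x \<in> set L \<Longrightarrow> y \<in> set L \<Longrightarrow> \<not> P x y \<Longrightarrow> \<exists>t \<in> S. Q t x \<and> Q t y"
  shows "sorted_wrt P L"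
  using assms
proof (induction L)
  case (Cons x L)
  have "P x y" if y: "y \<in> set L" for y
  proof (rule ccontr)
    assume "\<not> P x y"
    then obtain t where "t \<in> S" "Q t x" "Q t y" using Cons.prems(2)[of x y] y by auto
    then show False using Cons.prems(1)[of t] y \<open>\<not> P x y\<close> by auto
  qed
  moreover have "sorted_wrt P L"
  proof (rule Cons.IH)
    show "sorted_wrt P (filter (Q t) L)" if "t \<in> S" for t
      using Cons.prems(1)[OF that] by (auto split: if_splits)
  qed (use Cons.prems(2) in auto)
  ultimately show ?case by simp
qed simp

section \<open>Colourings as orderings\<close>

lemma topological_sort:
  assumes "finite A" "acyclic R"
  shows "\<exists>vs. distinct vs \<and> set vs = A \<and> sorted_wrt (\<lambda>x y. (y, x) \<notin> R) vs"
  using assms(1)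
proof (induction A rule: finite_psubset_induct)
  case (psubset A)
  show ?case
  proof (cases "A = {}")
    case True
    then show ?thesis by (intro exI[of _ "[]"]) simp
  next
    case False
    \<comment> \<open>\<open>R\<close> may be infinite; its restriction to the finite
      \<open>A\<close> is well-founded, and a minimal element goes to the front of the list.\<close>
    have "acyclic (R \<inter> A \<times> A)" using assms(2) by (rule acyclic_subset) auto
    then have "wf (R \<inter> A \<times> A)" using psubset.hyps by (intro finite_acyclic_wf) auto
    then obtain z where z: "z \<in> A" "\<And>y. (y, z) \<in> R \<inter> A \<times> A \<Longrightarrow> y \<notin> A"
      using False by (metis wfE_min ex_in_conv)
    have min: "(y, z) \<notin> R" if "y \<in> A" for y using z that by blast
    have "A - {z} \<subset> A" using z(1) by blast
    from psubset.IH[OF this] obtain vs where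
      vs: "distinct vs" "set vs = A - {z}" "sorted_wrt (\<lambda>x y. (y, x) \<notin> R) vs"
      by blast
    have "distinct (z # vs)" "set (z # vs) = A" "sorted_wrt (\<lambda>x y. (y, x) \<notin> R) (z # vs)"
      using vs z(1) min by auto
    then show ?thesis by blast
  qed
qed

text \<open>A closed walk may repeat vertices, but it contains a cycle; so simple cycles can be
  replaced by a transitive closure.\<close>

lemma (in wf_digraph) ex_cycle_iff: "(\<exists>p. cycle p) \<longleftrightarrow> \<not> acyclic (arcs_ends G)"
proof
  assume "\<exists>p. cycle p"
  then obtain u p where "awalk u p u" "p \<noteq> []" by (auto simp: cycle_def)
  then have "u \<rightarrow>\<^sup>+ u" using reachable1_awalk by blast
  then show "\<not> acyclic (arcs_ends G)" by (auto simp: acyclic_def)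
next
  assume "\<not> acyclic (arcs_ends G)"
  then obtain u where "u \<rightarrow>\<^sup>+ u" by (auto simp: acyclic_def)
  then obtain p where "awalk u p u" "p \<noteq> []" using reachable1_awalk by blast
  then have "closed_w p" by (auto simp: closed_w_def)
  then show "\<exists>p. cycle p" by (rule closed_w_imp_cycle)
qed

text \<open>Monochromatic arcs never leave a colour class, so a cycle in their union lies within one
  class. One acyclic relation thus replaces \<open>k\<close> subdigraphs.\<close>

lemma k_colorable_iff_acyclic:
  assumes "pair_digraph D"
  shows "k_colorable (with_proj D) k \<longleftrightarrow>
    (\<exists>f. (\<forall>v \<in> pverts D. f v < k) \<and> acyclic {(u, v) \<in> parcs D. f u = f v})"
proof -
  interpret pair_digraph D by fact
  have colour_class: "acyclic_digraph (with_proj D \<restriction> C) \<longleftrightarrow> acyclic (parcs D \<inter> C \<times> C)" for C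
  proof -
    interpret H: wf_digraph "with_proj D \<restriction> C" by unfold_locales auto
    have "arcs_ends (with_proj D \<restriction> C) = parcs D \<inter> C \<times> C"
      by (auto simp: arcs_ends_conv image_iff)
    then show ?thesis unfolding acyclic_digraph_def using H.ex_cycle_iff by simp
  qed
  have "(\<forall>i < k. acyclic (parcs D \<inter> {v \<in> pverts D. f v = i} \<times> {v \<in> pverts D. f v = i})) \<longleftrightarrow>
      acyclic {(u, v) \<in> parcs D. f u = f v}" (is "?L \<longleftrightarrow> acyclic ?R")
    if f: "\<forall>v \<in> pverts D. f v < k" for f :: "'a \<Rightarrow> nat"
  proof
    assume L: ?L
    show "acyclic ?R"
      unfolding acyclic_def
    proof safe
      fix u assume u: "(u, u) \<in> ?R\<^sup>+"
      define C where "C = {v \<in> pverts D. f v = f u}"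
      have "f v = f u \<and> (u, v) \<in> (parcs D \<inter> C \<times> C)\<^sup>+" if "(u, v) \<in> ?R\<^sup>+" for v
        using that
      proof (induction rule: trancl_induct)
        case (base y)
        then have "(u, y) \<in> parcs D \<inter> C \<times> C"
          using arc_fst_in_verts arc_snd_in_verts by (force simp: C_def)
        then show ?case using base by auto
      next
        case (step y z)
        then have "(y, z) \<in> parcs D \<inter> C \<times> C"
          using arc_fst_in_verts arc_snd_in_verts by (force simp: C_def)
        then show ?case using step by (auto intro: trancl_into_trancl)
      qed
      from this[OF u] have c: "(u, u) \<in> (parcs D \<inter> C \<times> C)\<^sup>+" by blast
      \<comment> \<open>Only vertices are known to have a colour below \<open>k\<close>, and
        \<open>?L\<close> speaks of such colours only.\<close>
      then have "u \<in> pverts D" by (metis (no_types, lifting) C_def IntE SigmaD1 mem_Collect_eq tranclD)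
      then have "acyclic (parcs D \<inter> C \<times> C)" using L f by (auto simp: C_def)
      then show False using c by (auto simp: acyclic_def)
    qed
  next
    assume "acyclic ?R"
    then show ?L by (auto elim!: acyclic_subset)
  qed
  then show ?thesis
    unfolding k_colorable_def colour_class with_proj_simps by blast
qed

text \<open>From a colouring, a topological sort of the monochromatic arcs gives the list.
  Conversely, positions in the list increase along monochromatic arcs, which excludes
  cycles.\<close>

lemma k_colorable_iff_ordering:
  assumes "pair_digraph D" "set as = parcs D"
  shows "k_colorable (with_proj D) k \<longleftrightarrow>
    (\<exists>L. distinct (map fst L) \<and> fst ` set L = pverts D \<and> (\<forall>x \<in> set L. snd x < k) \<and>
       sorted_wrt (forward as) L)"
proof -
  interpret pair_digraph D by fact
  show ?thesis
    unfolding k_colorable_iff_acyclic[OF assms(1)]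
  proof
    assume "\<exists>f. (\<forall>v \<in> pverts D. f v < k) \<and> acyclic {(u, v) \<in> parcs D. f u = f v}"
    then obtain f where f: "\<forall>v \<in> pverts D. f v < k" "acyclic {(u, v) \<in> parcs D. f u = f v}" by blast
    then obtain vs where vs: "distinct vs" "set vs = pverts D"
      "sorted_wrt (\<lambda>x y. (y, x) \<notin> {(u, v) \<in> parcs D. f u = f v}) vs"
      using topological_sort pair_finite_verts by blast
    have "sorted_wrt (forward as) (map (\<lambda>v. (v, f v)) vs)"
      unfolding sorted_wrt_map forward_def
      by (rule sorted_wrt_mono_rel[OF _ vs(3)]) (use assms(2) in auto)
    then show "\<exists>L. distinct (map fst L) \<and> fst ` set L = pverts D \<and> (\<forall>x \<in> set L. snd x < k) \<and>
       sorted_wrt (forward as) L"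
      using vs f(1) by (intro exI[of _ "map (\<lambda>v. (v, f v)) vs"]) (auto simp: o_def image_image)
  next
    assume "\<exists>L. distinct (map fst L) \<and> fst ` set L = pverts D \<and> (\<forall>x \<in> set L. snd x < k) \<and>
       sorted_wrt (forward as) L"
    then obtain L where L: "distinct (map fst L)" "fst ` set L = pverts D" "\<forall>x \<in> set L. snd x < k"
      "sorted_wrt (forward as) L" by blast
    define idx where "idx v = (THE i. i < length L \<and> fst (L ! i) = v)" for v
    have idx: "idx v < length L \<and> fst (L ! idx v) = v" if v: "v \<in> pverts D" for v
    proof -
      obtain x where "x \<in> set L" "fst x = v" using v L(2) by (metis imageE)
      then obtain i where i: "i < length L" "fst (L ! i) = v" by (metis in_set_conv_nth)
      show ?thesis
        unfolding idx_def
      proof (rule theI)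
        show "i < length L \<and> fst (L ! i) = v" using i by blast
        show "j = i" if "j < length L \<and> fst (L ! j) = v" for j
          using that i nth_eq_iff_index_eq[OF L(1), of i j] by auto
      qed
    qed
    define f where "f v = snd (L ! idx v)" for v
    \<comment> \<open>\<open>sorted_wrt\<close> compares different positions only and cannot see
      loops; these are excluded by \<open>pair_digraph\<close>.\<close>
    have "{(u, v) \<in> parcs D. f u = f v} \<subseteq> measure idx"
    proof clarify
      fix u v assume uv: "(u, v) \<in> parcs D" "f u = f v"
      then have V: "u \<in> pverts D" "v \<in> pverts D" "u \<noteq> v"
        using arc_fst_in_verts arc_snd_in_verts pair_no_loops by force+
      have "\<not> idx v < idx u"
      proof
        assume "idx v < idx u"
        then have "forward as (L ! idx v) (L ! idx u)"
          using L(4) idx[OF V(1)] by (auto simp: sorted_wrt_iff_nth_less)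
        then show False
          using uv idx[OF V(1)] idx[OF V(2)] assms(2) by (auto simp: forward_def f_def)
      qed
      moreover have "idx u \<noteq> idx v" using idx V by metis
      ultimately show "(u, v) \<in> measure idx" by simp
    qed
    then have "acyclic {(u, v) \<in> parcs D. f u = f v}"
      using wf_acyclic wf_measure acyclic_subset by blast
    moreover have "\<forall>v \<in> pverts D. f v < k"
      using idx L(3) by (auto simp: f_def)
    ultimately show "\<exists>f. (\<forall>v \<in> pverts D. f v < k) \<and> acyclic {(u, v) \<in> parcs D. f u = f v}" by blast
  qed
qed

text \<open>The identity gives all vertices different colours, so no arc is monochromatic.\<close>

lemma k_colorable_if_card_le:
  assumes "pair_digraph D" "pverts D = {..<n}" "n \<le> k"
  shows "k_colorable (with_proj D) k"
proof -
  interpret pair_digraph D by fact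
  have no_loop: "{(u, v) \<in> parcs D. id u = id v} = {}" using pair_no_loops by force
  have "acyclic {(u, v) \<in> parcs D. id u = id v}" unfolding no_loop by (simp add: acyclic_def)
  moreover have "\<forall>v \<in> pverts D. id v < k" using assms by auto
  ultimately show ?thesis
    unfolding k_colorable_iff_acyclic[OF assms(1)] by blast
qed

section \<open>Correctness of the table test\<close>

lemma linked_bag:
  assumes "pair_graph T" "Digraph_Component.connected (with_proj T \<restriction> A)"
  shows "linked (parcs T) A"
proof -
  interpret pair_graph T by fact
  have arcs: "parcs (mk_symmetric (with_proj T \<restriction> A)) = parcs T \<inter> A \<times> A"
    unfolding parcs_mk_symmetric using arcs_symmetric by auto
  have "(x, y) \<in> (parcs T \<inter> A \<times> A)\<^sup>*" if "(x, y) \<in> rtrancl_on A (parcs T \<inter> A \<times> A)" for x y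
    using that by (induction rule: rtrancl_on_induct) (auto intro: rtrancl.rtrancl_into_rtrancl)
  then show ?thesis
    using assms(2) unfolding linked_def Digraph_Component.connected_def strongly_connected_def
      reachable_def with_proj_simps pverts_mk_symmetric induce_subgraph_verts arcs by blast
qed

text \<open>Restrictions of one global list support each other, since restricting to two bags
  commutes; so no round can remove them.\<close>

lemma restr_ordering_in_table:
  assumes L: "distinct (map fst L)" "fst ` set L = V" "\<forall>x \<in> set L. snd x < k"
      "sorted_wrt (forward as) L"
    and bs: "\<And>t. t < m \<Longrightarrow> distinct (bs ! t) \<and> set (bs ! t) \<subseteq> V" and "t < m"
  shows "restr (bs ! t) L \<in> set ((prune es bs m ^^ r) (init_tables as bs k) t)"
  using assms(6)
proof (induction r arbitrary: t)
  case 0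
  have "fst ` set (restr (bs ! t) L) = set (bs ! t)"
    using bs[OF 0] L(2) by (auto simp: restr_def)
  moreover have "distinct (map fst (restr (bs ! t) L))"
    using L(1) by (auto simp: restr_def distinct_map inj_on_def)
  ultimately show ?case
    using L bs[OF 0] by (simp add: init_tables_def states_iff sorted_wrt_filter restr_def)
next
  case (Suc r)
  have "restr (bs ! t) (restr (bs ! j) L) = restr (bs ! j) (restr (bs ! t) L)" for j
    by (simp add: restr_def conj_commute)
  then show ?case using Suc by (auto simp: prune_iff)
qed

lemma k_colorable_iff_table_nonempty:
  assumes D: "pair_digraph D" "represents_digraph n as D"
    and td: "tree_decomposition (mk_symmetric (with_proj D)) T B"
    and T: "represents_digraph m es T" and bs: "represents_bags m bs B"
  shows "k_colorable (with_proj D) k \<longleftrightarrow> (prune es bs m ^^ m) (init_tables as bs k) 0 \<noteq> []"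
    and "0 < m"
proof -
  have as: "set as = parcs D" "pverts D = {..<n}" using D(2) by (auto simp: represents_digraph_def)
  have es: "set es = parcs T" "pverts T = {..<m}" using T by (auto simp: represents_digraph_def)
  have tree: "undirected_tree T"
    and cover: "(\<Union>t < m. B t) = {..<n}"
    and arcs: "\<And>u v. (u, v) \<in> parcs D \<Longrightarrow> \<exists>t < m. u \<in> B t \<and> v \<in> B t"
    and conn: "\<And>v. v < n \<Longrightarrow> Digraph_Component.connected (with_proj T \<restriction> {t \<in> {..<m}. v \<in> B t})"
    using td unfolding tree_decomposition_def es(2) pverts_mk_symmetric with_proj_simps as(2)
    by (auto simp: parcs_mk_symmetric)
  have B: "distinct (bs ! t)" "set (bs ! t) = B t" if "t < m" for t
    using bs that by (auto simp: represents_bags_def)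
  have Bn: "B t \<subseteq> {..<n}" if "t < m" for t using cover that by auto
  interpret T: pair_graph T using tree by (simp add: undirected_tree_def)
  have sym: "(v, u) \<in> set es \<and> u \<noteq> v" if "(u, v) \<in> set es" for u v
    using that T.arcs_symmetric T.pair_no_loops unfolding es by force
  have grown: "grown (set es) {..<m}" using grown_undirected_tree[OF tree] unfolding es .
  have "{..<m} \<noteq> {}" using grown by (induction rule: grown.induct) auto
  then show m: "0 < m" by auto
  have linked: "linked (set es) {t \<in> {..<m}. v \<in> set (bs ! t)}" for v
  proof -
    have eq: "{t \<in> {..<m}. v \<in> set (bs ! t)} = {t \<in> {..<m}. v \<in> B t}" using B(2) by auto
    show ?thesis
    proof (cases "v < n")
      case True
      then show ?thesis unfolding eq es using linked_bag[OF T.pair_graph conn] by blast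
    next
      case False
      then have "{t \<in> {..<m}. v \<in> B t} = {}" using Bn by auto
      then show ?thesis unfolding eq linked_def by blast
    qed
  qed
  show "k_colorable (with_proj D) k \<longleftrightarrow> (prune es bs m ^^ m) (init_tables as bs k) 0 \<noteq> []"
  proof
    assume "k_colorable (with_proj D) k"
    then obtain L where L: "distinct (map fst L)" "fst ` set L = {..<n}" "\<forall>x \<in> set L. snd x < k"
      "sorted_wrt (forward as) L"
      using k_colorable_iff_ordering[OF D(1) as(1)] as(2) by auto
    have "restr (bs ! 0) L \<in> set ((prune es bs m ^^ m) (init_tables as bs k) 0)"
      by (rule restr_ordering_in_table[OF L]) (use B Bn m in auto)
    then show "(prune es bs m ^^ m) (init_tables as bs k) 0 \<noteq> []" by auto
  next
    assume "(prune es bs m ^^ m) (init_tables as bs k) 0 \<noteq> []"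
    then obtain s where s: "s \<in> set ((prune es bs m ^^ m) (init_tables as bs k) 0)"
      using hd_in_set by blast
    have "\<exists>a. a 0 = s \<and> (\<forall>u \<in> {..<m}. a u \<in> set (init_tables as bs k u)) \<and>
        (\<forall>u \<in> {..<m}. \<forall>v \<in> {..<m}. (u, v) \<in> set es \<longrightarrow> restr (bs ! u) (a v) = restr (bs ! v) (a u))"
      by (rule prune_consistent[OF grown _ _ _ sym]) (use m s in auto)
    then obtain a where a: "\<forall>t \<in> {..<m}. a t \<in> set (init_tables as bs k t)"
      "\<forall>u \<in> {..<m}. \<forall>v \<in> {..<m}. (u, v) \<in> set es \<longrightarrow> restr (bs ! u) (a v) = restr (bs ! v) (a u)"
      by blast
    have a': "distinct (map fst (a t))" "fst ` set (a t) = B t" "\<forall>x \<in> set (a t). snd x < k"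
      "sorted_wrt (forward as) (a t)" if "t < m" for t
    proof -
      have "a t \<in> set (states (bs ! t) k)" and "sorted_wrt (forward as) (a t)"
        using a(1) that by (auto simp: init_tables_def)
      then show "distinct (map fst (a t))" "fst ` set (a t) = B t" "\<forall>x \<in> set (a t). snd x < k"
        "sorted_wrt (forward as) (a t)"
        using states_iff[OF B(1)[OF that]] B(2)[OF that] by auto
    qed
    have "\<exists>L. set L = (\<Union>t \<in> {..<m}. set (a t)) \<and> (\<forall>t \<in> {..<m}. restr (bs ! t) L = a t)"
      by (rule glue_states[OF grown sym linked]) (use a' a(2) B in auto)
    then obtain L where L: "set L = (\<Union>t < m. set (a t))" "\<forall>t < m. restr (bs ! t) L = a t" by auto
    have fstL: "fst ` set L = {..<n}"
      unfolding L(1) image_UN using a'(2) cover by simp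
    \<comment> \<open>Distinctness of the vertices is added as a pairwise condition, so that it is
      lifted from the bags to \<open>L\<close> together with \<open>forward\<close>.\<close>
    have "sorted_wrt (\<lambda>x y. fst x \<noteq> fst y \<and> forward as x y) L"
    proof (rule sorted_wrt_if_filters[where S = "{..<m}" and Q = "\<lambda>t x. fst x \<in> set (bs ! t)"])
      fix t assume "t \<in> {..<m}"
      then have t: "t < m" by simp
      have "filter (\<lambda>x. fst x \<in> set (bs ! t)) L = a t" using L(2) t by (simp add: restr_def)
      then show "sorted_wrt (\<lambda>x y. fst x \<noteq> fst y \<and> forward as x y) (filter (\<lambda>x. fst x \<in> set (bs ! t)) L)"
        using a'(1,4)[OF t] by (auto simp: sorted_wrt_iff_nth_less distinct_conv_nth)
    next
      \<comment> \<open>A violating pair has equal vertices, which lie in a bag by the covering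
        property, or its vertices are the ends of an arc, which share a bag.\<close>
      fix x y assume xy: "x \<in> set L" "y \<in> set L" "\<not> (fst x \<noteq> fst y \<and> forward as x y)"
      have "fst x < n" using fstL xy(1) by auto
      then obtain t where "t < m" "fst x \<in> B t" using cover by blast
      moreover have "\<exists>t < m. fst y \<in> B t \<and> fst x \<in> B t" if "fst x \<noteq> fst y"
        using xy(3) that arcs as(1) by (auto simp: forward_def)
      ultimately show "\<exists>t \<in> {..<m}. fst x \<in> set (bs ! t) \<and> fst y \<in> set (bs ! t)"
        using B(2) by (cases "fst x = fst y") auto
    qed
    then have "distinct (map fst L)" "sorted_wrt (forward as) L"
      by (auto simp: sorted_wrt_iff_nth_less distinct_conv_nth) (metis linorder_neqE_nat)
    moreover have "\<forall>x \<in> set L. snd x < k" unfolding L(1) using a'(3) by auto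
    ultimately show "k_colorable (with_proj D) k"
      using k_colorable_iff_ordering[OF D(1) as(1)] as(2) fstL by auto
  qed
qed

text \<open>\<open>max 1 k\<close> keeps the bound positive for \<open>k = 0\<close>, as every run
  takes at least one step. The polynomial is in \<open>n + m\<close> because the number of nodes of
  the given tree is not bounded in terms of \<open>n\<close>.\<close>

theorem theorem9:
  "\<exists>(p :: prog) (c :: nat) (d :: nat).
     \<forall>(D :: nat pair_pre_digraph) (n :: nat) (k :: nat)
      (T :: nat pair_pre_digraph) (m :: nat) (B :: nat \<Rightarrow> nat set) (tw :: nat) as es bs.
       pair_digraph D \<and> represents_digraph n as D \<and>
       tree_decomposition (mk_symmetric (with_proj D)) T B \<and> td_width T B = tw \<and>
       represents_digraph m es T \<and> represents_bags m bs B \<longrightarrow>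
       (\<exists>t. runs p (enc_instance n as k m es bs) (enc_bool (k_colorable (with_proj D) k)) t \<and>
            t \<le> c * max 1 k ^ tw * fact tw * (n + m) ^ d)"
proof -
  obtain c d where cd: "\<And>N W. N \<ge> 1 \<Longrightarrow> W \<ge> 1 \<Longrightarrow> c_main N W \<le> c * N ^ d * W"
    using lin_bounded_main unfolding lin_bounded_def by blast
  have "\<exists>t. runs colouring_prog (enc_instance n as k m es bs) (enc_bool (k_colorable (with_proj D) k)) t \<and>
            t \<le> c * max 1 k ^ tw * fact tw * (n + m) ^ (d + 2)"
    if D: "pair_digraph D" "represents_digraph n as D"
      and td: "tree_decomposition (mk_symmetric (with_proj D)) T B" and tw: "td_width T B = tw"
      and T: "represents_digraph m es T" and bs: "represents_bags m bs B"
    for D n k T m B tw as es bs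
  proof -
    interpret D: pair_digraph D by fact
    have as: "set as = parcs D" "pverts D = {..<n}" "distinct as"
      using D(2) by (auto simp: represents_digraph_def)
    have es: "set es = parcs T" "pverts T = {..<m}" "distinct es"
      using T by (auto simp: represents_digraph_def)
    interpret T: pair_graph T using td by (simp add: tree_decomposition_def undirected_tree_def)
    note iff = k_colorable_iff_table_nonempty[OF D td T bs]
    define N where "N = n + m"
    \<comment> \<open>For \<open>n \<le> k\<close> no table is built, and \<open>W = 1\<close>
      avoids a surplus factor \<open>k\<close> that would have no bound in terms of
      \<open>n\<close>.\<close>
    define W where "W = (if n \<le> k then 1 else max 1 k ^ (tw + 1) * fact (tw + 1))"
    have N: "N \<ge> 1" using iff(2) by (simp add: N_def)
    have W: "W \<ge> 1" by (auto simp: W_def Suc_le_eq)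
    have len: "length xs \<le> N * N" if "distinct xs" "set xs \<subseteq> {..<N} \<times> {..<N}" for xs :: "(nat \<times> nat) list"
      using card_mono[OF _ that(2)] distinct_card[OF that(1)] by simp
    have las: "length as \<le> N * N"
      using D.arc_fst_in_verts D.arc_snd_in_verts unfolding as(2)
      by (intro len as(3)) (fastforce simp: as(1) N_def)
    have les: "length es \<le> N * N"
      using T.arc_fst_in_verts T.arc_snd_in_verts unfolding es(2)
      by (intro len es(3)) (fastforce simp: es(1) N_def)
    have bag: "distinct (bs ! i)" "set (bs ! i) \<subseteq> {..<n}" "length (bs ! i) \<le> tw + 1" if "i < m" for i
    proof -
      show dist: "distinct (bs ! i)" using bs that by (simp add: represents_bags_def)
      have Bi: "set (bs ! i) = B i" using bs that by (simp add: represents_bags_def)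
      have "(\<Union>t \<in> pverts T. B t) = {..<n}"
        using td as(2) by (simp add: tree_decomposition_def)
      then show "set (bs ! i) \<subseteq> {..<n}" using es(2) that Bi by auto
      have "card (B i) \<le> Max ((\<lambda>t. card (B t)) ` pverts T)"
        using es(2) that by (intro Max_ge) auto
      \<comment> \<open>Truncated subtraction does no harm: if all bags are empty, \<open>tw\<close>
        is 0 and the inequality still holds.\<close>
      then show "length (bs ! i) \<le> tw + 1"
        using tw distinct_card[OF dist] Bi by (simp add: td_width_def)
    qed
    have lb: "length (bs ! i) \<le> n" if "i < m" for i
      using card_mono[OF _ bag(2)[OF that]] distinct_card[OF bag(1)[OF that]] by simp
    have "\<exists>t \<le> c_main N W. runs colouring_prog (enc_instance n as k m es bs)
           (enc_bool (n \<le> k \<or> (prune es bs m ^^ m) (init_tables as bs k) 0 \<noteq> [])) t"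
    proof (rule computes_main[OF las les])
      fix i assume i: "i < m"
      have "max 1 k ^ length (bs ! i) * fact (length (bs ! i)) \<le> max 1 k ^ (tw + 1) * fact (tw + 1)"
        by (intro mult_le_mono power_increasing fact_mono) (use bag(3)[OF i] in auto)
      moreover have "set (bs ! i) \<subseteq> {..N}" "length (bs ! i) \<le> N"
        using bag(2)[OF i] lb[OF i] by (auto simp: N_def)
      ultimately show "distinct (bs ! i) \<and> set (bs ! i) \<subseteq> {..N} \<and> length (bs ! i) \<le> N \<and>
        max 1 k ^ length (bs ! i) * fact (length (bs ! i)) \<le> W \<or> n \<le> k"
        using bag(1)[OF i] by (simp add: W_def)
    qed (use iff(2) bs in \<open>auto simp: N_def represents_bags_def\<close>)
    moreover have "n \<le> k \<or> (prune es bs m ^^ m) (init_tables as bs k) 0 \<noteq> [] \<longleftrightarrow>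
        k_colorable (with_proj D) k"
      using iff(1) k_colorable_if_card_le[OF D(1) as(2)] by blast
    ultimately obtain t where t: "t \<le> c_main N W"
      "runs colouring_prog (enc_instance n as k m es bs) (enc_bool (k_colorable (with_proj D) k)) t"
      by auto
    have "W \<le> max 1 k ^ tw * fact tw * N ^ 2"
    proof (cases "n \<le> k")
      case True
      have "1 * 1 * 1 \<le> max 1 k ^ tw * fact tw * N ^ 2"
        using N by (intro mult_le_mono) (auto simp: Suc_le_eq)
      then show ?thesis using True by (simp add: W_def)
    next
      case False
      have "Max ((\<lambda>t. card (B t)) ` pverts T) \<in> (\<lambda>t. card (B t)) ` pverts T"
        using es(2) iff(2) by (intro Max_in) auto
      then obtain i where i: "i < m" "Max ((\<lambda>t. card (B t)) ` pverts T) = card (B i)"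
        using es(2) by auto
      have "card (B i) \<le> n"
        using lb[OF i(1)] distinct_card[OF bag(1)[OF i(1)]] bs i(1) by (simp add: represents_bags_def)
      then have "tw + 1 \<le> N" using tw i(2) False iff(2) by (simp add: td_width_def N_def)
      moreover have "max 1 k \<le> N" using False by (simp add: N_def)
      \<comment> \<open>\<open>max 1 k * (tw + 1)\<close> is the quotient of the counts for
        \<open>tw + 1\<close> and \<open>tw\<close> vertices; bounding it by \<open>N * N\<close> is
        the origin of the exponent \<open>d + 2\<close>.\<close>
      ultimately have "(max 1 k ^ tw * fact tw) * (max 1 k * (tw + 1)) \<le> (max 1 k ^ tw * fact tw) * (N * N)"
        by (intro mult_le_mono) auto
      then show ?thesis using False by (simp add: W_def power2_eq_square algebra_simps)
    qed
    then have "c * N ^ d * W \<le> c * N ^ d * (max 1 k ^ tw * fact tw * N ^ 2)" by simp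
    also have "\<dots> = c * max 1 k ^ tw * fact tw * (n + m) ^ (d + 2)"
      by (simp add: N_def power_add power2_eq_square mult.assoc mult.left_commute mult.commute)
    finally show ?thesis using t cd[OF N W] by (meson le_trans)
  qed
  then show ?thesis by blast
qed

end
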